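(* Let $\gamma>0$, let $B_1\in L(W,H)$, $B_2\in L(U,H)$, and set $\Gamma:=B_2B_2^*-\gamma^{-2}B_1B_1^*$. Let $A:V\to V'$ be linear and continuous, such that $-A$ generates a $C_0$-semigroup on $H$. Assume that one of the following two sets of hypotheses holds: (i) there is $\omega>0$ with $\langle Ay,y\rangle_{V',V}\ge\omega\|y\|_V^2$ for all $y\in V$; $\Gamma\in\mathcal H$, $\Gamma=\Gamma^*$, $\Gamma\ge0$; and $C_1\in\mathcal H$; (ii) $\langle Ay,y\rangle_{V',V}\ge0$ for all $y\in V$; $C_1\in(V',H)_{H.S.}$ with $\ker C_1=\{0\}$; $\Gamma\in\mathcal H$, $\Gamma=\Gamma^*$, and there is $g_0>0$ with $(\Gamma y,y)_H\ge g_0\|y\|_H^2$ for any $y\in H$. Let $P\in\mathcal V$, $P=P^*$, $P\ge0$, be the solution to the Riccati equation $$A^*P+PA+P(B_2B_2^*-\gamma^{-2}B_1B_1^* )P=C_1^*C_1,$$ and assume that $-A-B_2B_2^*P$ generates an exponentially stable semigroup on $H$. Let $\Phi:L^2(\mathbb R_+;H)\times L^2(\mathbb R_+;U)\to L^2(\mathbb R_+;Z)$, with $Z=H$, satisfy $\|\Phi(y(t),u(t))\|_Z^2\le\|C_1y(t)\|_Z^2+\|u(t)\|_U^2$. Then the feedback operator $F=-B_2^*P$ solves the $H^\infty$-control problem associated to the system $$y'(t)+Ay(t)=B_1w(t)+B_2u(t),\quad z(t)=\Phi(y(t),u(t)),\quad t>0,\qquad y(0)=0;$$ that is, $-A+B_2F$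 generates an exponentially stable semigroup on $H$, and for every $w\in L^2(\mathbb R_+;W)$ the output $z=\Phi(y,u)$ of the system with $u=Fy$ satisfies $$\|z\|_{L^2(\mathbb R_+;Z)}=\|\Phi(y,u)\|_{L^2(\mathbb R_+;Z)}\le\gamma\|w\|_{L^2(\mathbb R_+;W)}.$$
   Context: $V,H,W,U,Z$ are real Hilbert spaces, with $V$ and $H$ separable; $H,W,U,Z$ are identified with their duals; $V'$ is the dual of $V$, and $V\subset H\subset V'$ with dense and continuous injections, the embedding $V\subset H$ being compact. $L(H_1,H_2)$ is the space of linear continuous operators; $\mathbb R_+=(0,\infty)$. $\langle\cdot,\cdot\rangle_{V',V}$ is the duality pairing. For separable Hilbert spaces $H_1,H_2$, $(H_1,H_2)_{H.S.}$ is the Hilbert space of Hilbert–Schmidt operators from $H_1$ to $H_2$. Set $\mathcal H:=(H,H)_{H.S.}$ and $\mathcal V:=(V',H)_{H.S.}\cap(H,V)_{H.S.}$; thus $P\in\mathcal V$ means that $P\in\mathcal H$ maps $H$ into $V$ as a Hilbert–Schmidt operator and extends to a Hilbert–Schmidt operator from $V'$ to $H$ (still denoted $P$). $C_1^*$ is the adjoint of $C_1$ as an operator on $H$. $A^*:V\to V'$ is given by $\langle A^*u,v\rangle_{V',V}=\langle Av,u\rangle_{V',V}$; the Riccati equation is understood in $\mathcal V'=(V,H)_{H.S.}+(H,V')_{H.S.}$, i.e. applied to each $y\in V$ it holds in $V'$. $T\ge0$ means $(Ty,y)_H\ge0$ for all $y\in H$. When $A$ is regarded as an operator in $H$, its domain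 is $D(A)=\{y\in V: Ay\in H\}$. A semigroup $e^{Gt}$ on $H$ with generator $G$ is exponentially stable if there are $C>0$, $\alpha>0$ with $\|e^{Gt}y\|_H\le Ce^{-\alpha t}\|y\|_H$ for all $y\in H$, $t\ge 0$. The state with $u=Fy$ is the mild solution $y(t)=\int_0^te^{(-A+B_2F)(t-s)}B_1w(s)\,ds$. The inequality on $\Phi$ is understood for a.e. $t>0$, with $\Phi(y(t),u(t))$ denoting the value at $t$ of $\Phi(y,u)$. *)

theory Defs
  imports "HOL-Analysis.Analysis"
begin

text \<open>
  Real Hilbert spaces are types of sort {real_inner, complete_space}; separable ones have sort
  {real_inner, polish_space}.  The dual V' is the type of bounded functionals on V.  The inclusion
  of V in H is an injective bounded operator \<open>\<iota>\<close>, and an element h of H is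
  identified with the functional \<open>pivot \<iota> h\<close>, mapping v to (h, \<open>\<iota>\<close> v).
\<close>

definition pivot :: "('v::real_inner \<Rightarrow>\<^sub>L 'h::real_inner) \<Rightarrow> 'h \<Rightarrow> ('v \<Rightarrow>\<^sub>L real)" where
  "pivot \<iota> h = blinfun_inner_right h o\<^sub>L \<iota>"

lemma pivot_apply: "pivot \<iota> h v = h \<bullet> \<iota> v"
  by (simp add: pivot_def)

definition compact_gelfand_triple :: "('v::real_inner \<Rightarrow>\<^sub>L 'h::real_inner) \<Rightarrow> bool" where
  "compact_gelfand_triple \<iota> \<longleftrightarrow>
     inj \<iota> \<and> closure (range \<iota>) = UNIV \<and>
     inj (pivot \<iota>) \<and> closure (range (pivot \<iota>)) = UNIV \<and>
     (\<forall>S. bounded S \<longrightarrow> compact (closure (\<iota> ` S)))"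


section \<open>Operators\<close>

definition orthonormal_basis :: "'a::real_inner set \<Rightarrow> bool" where
  "orthonormal_basis E \<longleftrightarrow>
     pairwise orthogonal E \<and> (\<forall>e\<in>E. norm e = 1) \<and> closure (span E) = UNIV"

text \<open>The sum below does not depend on the choice of the orthonormal basis.\<close>

definition hilbert_schmidt :: "('a::real_inner \<Rightarrow> 'b::real_inner) \<Rightarrow> bool" where
  "hilbert_schmidt T \<longleftrightarrow>
     bounded_linear T \<and> (\<exists>E. orthonormal_basis E \<and> (\<lambda>e. (norm (T e))\<^sup>2) summable_on E)"

text \<open>
  The Hilbert space structure of V' is the one making the Riesz map
  \<open>blinfun_inner_right\<close> from V onto V' unitary: if E is an orthonormal basis of V, then
  \<open>blinfun_inner_right ` E\<close> is an orthonormal basis of V'.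
\<close>

definition hilbert_schmidt_dual :: "(('v::real_inner \<Rightarrow>\<^sub>L real) \<Rightarrow> 'b::real_inner) \<Rightarrow> bool" where
  "hilbert_schmidt_dual T \<longleftrightarrow>
     bounded_linear T \<and>
     (\<exists>E. orthonormal_basis E \<and> (\<lambda>e. (norm (T (blinfun_inner_right e)))\<^sup>2) summable_on E)"

text \<open>
  \<open>P\<close> belongs to the intersection of (V',H) and (H,V): \<open>PV\<close> is \<open>P\<close> regarded as an operator from
  H to V, and \<open>PD\<close> is its extension to V'.  Both are uniquely determined by \<open>P\<close>.
\<close>

definition in_calV ::
  "('v::real_inner \<Rightarrow>\<^sub>L 'h::real_inner) \<Rightarrow> ('h \<Rightarrow>\<^sub>L 'h) \<Rightarrow> ('h \<Rightarrow>\<^sub>L 'v) \<Rightarrow> (('v \<Rightarrow>\<^sub>L real) \<Rightarrow>\<^sub>L 'h) \<Rightarrow> bool"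
  where
  "in_calV \<iota> P PV PD \<longleftrightarrow>
     hilbert_schmidt P \<and>
     hilbert_schmidt PV \<and> (\<forall>x. \<iota> (PV x) = P x) \<and>
     hilbert_schmidt_dual PD \<and> (\<forall>x. PD (pivot \<iota> x) = P x)"

definition dual_op :: "('v::real_normed_vector \<Rightarrow>\<^sub>L ('v \<Rightarrow>\<^sub>L real)) \<Rightarrow> 'v \<Rightarrow> ('v \<Rightarrow>\<^sub>L real)" where
  "dual_op A u = Blinfun (\<lambda>v. A v u)"

lemma dual_op_apply: "dual_op A u v = A v u"
proof -
  have "bounded_linear (\<lambda>v. A v u)"
    by (intro bounded_linear_intros)
  then show ?thesis
    by (simp add: dual_op_def bounded_linear_Blinfun_apply)
qed

definition Gam ::
  "real \<Rightarrow> ('w::real_inner \<Rightarrow>\<^sub>L 'h::real_inner) \<Rightarrow> ('u::real_inner \<Rightarrow>\<^sub>L 'h) \<Rightarrow> 'h \<Rightarrow> 'h" where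
  "Gam \<gamma> B1 B2 x = B2 (adjoint B2 x) - (1 / \<gamma>\<^sup>2) *\<^sub>R B1 (adjoint B1 x)"

text \<open>The equation in V', for every y in V.\<close>

definition riccati ::
  "('v::real_inner \<Rightarrow>\<^sub>L 'h::real_inner) \<Rightarrow> ('v \<Rightarrow>\<^sub>L ('v \<Rightarrow>\<^sub>L real)) \<Rightarrow> ('h \<Rightarrow> 'h) \<Rightarrow> ('h \<Rightarrow>\<^sub>L 'h) \<Rightarrow>
   ('h \<Rightarrow>\<^sub>L 'h) \<Rightarrow> ('h \<Rightarrow>\<^sub>L 'v) \<Rightarrow> (('v \<Rightarrow>\<^sub>L real) \<Rightarrow>\<^sub>L 'h) \<Rightarrow> bool" where
  "riccati \<iota> A \<Gamma> C1 P PV PD \<longleftrightarrow>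
     (\<forall>y. dual_op A (PV (\<iota> y)) + pivot \<iota> (PD (A y)) + pivot \<iota> (P (\<Gamma> (P (\<iota> y))))
          = pivot \<iota> (adjoint C1 (C1 (\<iota> y))))"


section \<open>Semigroups\<close>

text \<open>Only the values \<open>S t\<close> with \<open>t \<ge> 0\<close> matter.\<close>

definition C0_semigroup :: "(real \<Rightarrow> 'h::real_normed_vector \<Rightarrow>\<^sub>L 'h) \<Rightarrow> bool" where
  "C0_semigroup S \<longleftrightarrow>
     S 0 = id_blinfun \<and>
     (\<forall>s\<ge>0. \<forall>t\<ge>0. S (s + t) = S s o\<^sub>L S t) \<and>
     (\<forall>x. ((\<lambda>t. S t x) \<longlongrightarrow> x) (at_right 0))"

text \<open>Unbounded operators in H are represented by their graphs.\<close>

definition generator :: "(real \<Rightarrow> 'h::real_normed_vector \<Rightarrow>\<^sub>L 'h) \<Rightarrow> ('h \<times> 'h) set" where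
  "generator S = {(x, z). ((\<lambda>t. (1 / t) *\<^sub>R (S t x - x)) \<longlongrightarrow> z) (at_right 0)}"

definition generates :: "('h \<times> 'h) set \<Rightarrow> (real \<Rightarrow> 'h::real_normed_vector \<Rightarrow>\<^sub>L 'h) \<Rightarrow> bool" where
  "generates G S \<longleftrightarrow> C0_semigroup S \<and> generator S = G"

definition exponentially_stable :: "(real \<Rightarrow> 'h::real_normed_vector \<Rightarrow>\<^sub>L 'h) \<Rightarrow> bool" where
  "exponentially_stable S \<longleftrightarrow>
     (\<exists>C>0. \<exists>\<alpha>>0. \<forall>y. \<forall>t\<ge>0. norm (S t y) \<le> C * exp (- \<alpha> * t) * norm y)"

text \<open>The operator \<open>-A + K\<close> in H, with domain \<open>D(A) = {y \<in> V. A y \<in> H}\<close>.\<close>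

definition minus_plus ::
  "('v::real_inner \<Rightarrow>\<^sub>L 'h::real_inner) \<Rightarrow> ('v \<Rightarrow>\<^sub>L ('v \<Rightarrow>\<^sub>L real)) \<Rightarrow> ('h \<Rightarrow> 'h) \<Rightarrow> ('h \<times> 'h) set" where
  "minus_plus \<iota> A K = {(\<iota> y, - h + K (\<iota> y)) | y h. A y = pivot \<iota> h}"


section \<open>Square-integrable functions on the positive half-line\<close>

text \<open>
  W and U need not be separable, so measurability is strong (Bochner) measurability.  Elements of
  \<open>L2\<close> are functions, to be identified when they agree almost everywhere on the half-line.
\<close>

abbreviation half_line :: "real measure" where
  "half_line \<equiv> lebesgue_on {0<..}"

definition strongly_measurable :: "'t measure \<Rightarrow> ('t \<Rightarrow> 'a::topological_space) \<Rightarrow> bool" where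
  "strongly_measurable M f \<longleftrightarrow>
     (\<exists>s. (\<forall>i::nat. simple_function M (s i)) \<and> (AE t in M. (\<lambda>i. s i t) \<longlonglongrightarrow> f t))"

definition L2 :: "(real \<Rightarrow> 'a::real_normed_vector) set" where
  "L2 = {f. strongly_measurable half_line f \<and> integrable half_line (\<lambda>t. (norm (f t))\<^sup>2)}"

definition L2_norm :: "(real \<Rightarrow> 'a::real_normed_vector) \<Rightarrow> real" where
  "L2_norm f = sqrt (LINT t|half_line. (norm (f t))\<^sup>2)"

text \<open>A map of almost-everywhere classes, expressed on representatives.\<close>

definition L2_map ::
  "((real \<Rightarrow> 'a::real_normed_vector) \<Rightarrow> (real \<Rightarrow> 'b::real_normed_vector) \<Rightarrow>
    (real \<Rightarrow> 'c::real_normed_vector)) \<Rightarrow> bool" where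
  "L2_map \<Phi> \<longleftrightarrow>
     (\<forall>y\<in>L2. \<forall>u\<in>L2. \<Phi> y u \<in> L2) \<and>
     (\<forall>y\<in>L2. \<forall>y'\<in>L2. \<forall>u\<in>L2. \<forall>u'\<in>L2.
        (AE t in half_line. y t = y' t) \<longrightarrow> (AE t in half_line. u t = u' t) \<longrightarrow>
        (AE t in half_line. \<Phi> y u t = \<Phi> y' u' t))"


section \<open>The control problem\<close>

definition mild_state ::
  "(real \<Rightarrow> 'h \<Rightarrow>\<^sub>L 'h) \<Rightarrow> ('w::real_inner \<Rightarrow>\<^sub>L 'h::{real_inner, polish_space}) \<Rightarrow> (real \<Rightarrow> 'w) \<Rightarrow>
   real \<Rightarrow> 'h" where
  "mild_state S B1 w t = (LINT s|lebesgue_on {0..t}. S (t - s) (B1 (w s)))"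

text \<open>
  A semigroup is determined by its generator, so \<open>S\<close> is the semigroup generated by
  \<open>-A + B2 F\<close>.  The memberships in \<open>L2\<close> of the state, the control and the output say that
  \<open>\<Phi> y u\<close> and its norm are meaningful.
\<close>

definition solves_Hinf_problem ::
  "real \<Rightarrow> ('v::real_inner \<Rightarrow>\<^sub>L 'h::{real_inner, polish_space}) \<Rightarrow> ('v \<Rightarrow>\<^sub>L ('v \<Rightarrow>\<^sub>L real)) \<Rightarrow>
   ('w::real_inner \<Rightarrow>\<^sub>L 'h) \<Rightarrow> ('u::real_inner \<Rightarrow>\<^sub>L 'h) \<Rightarrow>
   ((real \<Rightarrow> 'h) \<Rightarrow> (real \<Rightarrow> 'u) \<Rightarrow> (real \<Rightarrow> 'z::real_normed_vector)) \<Rightarrow> ('h \<Rightarrow> 'u) \<Rightarrow> bool" where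
  "solves_Hinf_problem \<gamma> \<iota> A B1 B2 \<Phi> F \<longleftrightarrow>
     (\<exists>S. generates (minus_plus \<iota> A (\<lambda>x. B2 (F x))) S \<and> exponentially_stable S \<and>
       (\<forall>w\<in>L2.
         let y = mild_state S B1 w; u = (\<lambda>t. F (y t))
         in y \<in> L2 \<and> u \<in> L2 \<and> \<Phi> y u \<in> L2 \<and> L2_norm (\<Phi> y u) \<le> \<gamma> * L2_norm w))"

end

theory Submission
  imports Defs
begin

text \<open>
  Along \<open>y' = (-A - B2 B2* P) y + B1 w\<close> the Riccati equation gives
  \<open>d/dt (P y, y) = - |C1 y|^2 - |u|^2 + \<gamma>^2 |w|^2 - |\<gamma> w - B1* P y / \<gamma>|^2\<close> with \<open>u = - B2* P y\<close>;
  integrating from \<open>y(0) = 0\<close> and using \<open>P \<ge> 0\<close> yields the estimate.  A mild solution need not be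
  differentiable.  For the homogeneous flow the energy identity is extended from the domain of the
  generator by density.  For the mild solution, the increments of \<open>(P y, y)\<close> over the cells of a
  partition are integrals of explicit functions, which converge dominatedly to the rate above as the
  mesh tends to 0.  The same identity for the scalar semigroup \<open>exp (-\<alpha> t)\<close> shows that the state is
  square-integrable.
\<close>

text \<open>The map \<Phi> acts on whole trajectories, and its bound is available only for a state
  and a control already known to lie in \<open>L2\<close>. Square-integrability of the state
  therefore has to come from stability alone, before anything can be said about the output. The
  input is merely square-integrable, so the state need not enter the domain of the generator, and
  the rate of change of (P y, y) is only an integrable function; dominated convergence takes the
  place of the fundamental theorem of calculus. On a cell from a to b, let x be the value at b of
  the free flow started from y(a). Symmetry of P gives (P y(b), y(b)) - (P x, x) = (P (y(b) + x),
  y(b) - x). The second factor is the integral of the transported input over the cell, and the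
  remaining increment (P x, x) - (P y(a), y(a)) belongs to the homogeneous flow. In this way no
  approximation of the input by smoother ones enters.\<close>

section \<open>Riesz representation and Hilbert space adjoints\<close>

text \<open>Direct method: the functional |x|^2 - 2 f x is bounded below by -K^2, the parallelogram
  law at midpoints makes a minimizing sequence Cauchy, and stationarity at its limit is the
  representation.\<close>

lemma riesz_representation:
  fixes f :: "'a::{real_inner,complete_space} \<Rightarrow> real"
  assumes "bounded_linear f"
  shows "\<exists>y. \<forall>x. f x = x \<bullet> y"
proof -
  interpret f: bounded_linear f by fact
  define J where "J x = (norm x)\<^sup>2 - 2 * f x" for x
  obtain K where K: "\<And>x. norm (f x) \<le> norm x * K" and "K \<ge> 0"
    using f.nonneg_bounded by blast
  have lower: "- K\<^sup>2 \<le> J x" for x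
  proof -
    have "f x \<le> norm x * K" using K[of x] by simp
    moreover have "0 \<le> (norm x - K)\<^sup>2" by simp
    ultimately show ?thesis by (simp add: J_def power2_eq_square algebra_simps)
  qed
  define m where "m = Inf (range J)"
  have bdd: "bdd_below (range J)" using lower by (auto intro!: bdd_belowI)
  have m: "m \<le> J x" for x unfolding m_def by (rule cInf_lower) (auto simp: bdd)
  have "\<exists>x. J x < m + 1 / Suc n" for n
    using cInf_lessD[of "range J" "m + 1 / Suc n"] by (auto simp: m_def)
  then obtain X where X: "\<And>n. J (X n) < m + 1 / Suc n" by metis
  have par: "(norm (x - y))\<^sup>2 \<le> 2 * (J x - m) + 2 * (J y - m)" for x y
  proof -
    have "J x + J y = 2 * J ((1/2) *\<^sub>R (x + y)) + (norm (x - y))\<^sup>2 / 2"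
      by (simp add: J_def f.scaleR f.add power2_norm_eq_inner inner_simps inner_commute field_simps)
    with m[of "(1/2) *\<^sub>R (x + y)"] show ?thesis by simp
  qed
  have "Cauchy X"
  proof (rule metric_CauchyI)
    fix e :: real assume "e > 0"
    then obtain N where N: "1 / Suc N < e\<^sup>2 / 4"
      using reals_Archimedean[of "e\<^sup>2 / 4"] by (auto simp: inverse_eq_divide)
    have "dist (X i) (X j) < e" if "i \<ge> N" "j \<ge> N" for i j
    proof -
      have le: "1 / real (Suc k) \<le> 1 / Suc N" if "k \<ge> N" for k
        using that by (intro divide_left_mono) auto
      have J: "J (X k) - m < e\<^sup>2 / 4" if "k \<ge> N" for k
        using X[of k] le[OF that] N by linarith
      have "(norm (X i - X j))\<^sup>2 < e\<^sup>2"
        using par[of "X i" "X j"] J[OF that(1)] J[OF that(2)] by (simp add: field_simps)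
      with \<open>e > 0\<close> show ?thesis by (simp add: dist_norm power2_less_imp_less)
    qed
    then show "\<exists>M. \<forall>i\<ge>M. \<forall>j\<ge>M. dist (X i) (X j) < e" by blast
  qed
  then obtain x where x: "X \<longlonglongrightarrow> x" using Cauchy_convergent convergent_def by blast
  have "(\<lambda>n. J (X n)) \<longlonglongrightarrow> J x"
    unfolding J_def by (intro tendsto_intros x f.tendsto)
  moreover have "(\<lambda>n. m + 1 / Suc n) \<longlonglongrightarrow> m + 0"
    by (intro tendsto_intros LIMSEQ_Suc[OF lim_1_over_n])
  ultimately have "J x \<le> m + 0"
    using X by (intro LIMSEQ_le) (auto intro: less_imp_le)
  then have min: "J x \<le> J z" for z using m[of z] by simp
  have "f v = v \<bullet> x" for v
  proof (cases "v = 0")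
    case False
    define c where "c = v \<bullet> x - f v"
    \<comment> \<open>This t minimizes J along the line x + t v. The resulting drop c^2 / (v . v)
      contradicts the minimality of x unless c = 0.\<close>
    define t where "t = - c / (v \<bullet> v)"
    have vv: "v \<bullet> v > 0" using False by simp
    have "(norm (x + t *\<^sub>R v))\<^sup>2 = (norm x)\<^sup>2 + 2 * t * (v \<bullet> x) + t\<^sup>2 * (v \<bullet> v)"
      unfolding power2_norm_eq_inner by (simp add: inner_simps inner_commute power2_eq_square)
    then have "J (x + t *\<^sub>R v) = J x + 2 * t * c + t\<^sup>2 * (v \<bullet> v)"
      by (simp add: J_def c_def f.scaleR f.add algebra_simps)
    also have "\<dots> = J x - c\<^sup>2 / (v \<bullet> v)"
      using vv by (simp add: t_def power2_eq_square field_simps)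
    finally have "c\<^sup>2 / (v \<bullet> v) \<le> 0" using min[of "x + t *\<^sub>R v"] by simp
    moreover have "0 < c\<^sup>2 / (v \<bullet> v)" if "c \<noteq> 0"
      using that vv by (intro divide_pos_pos) simp_all
    ultimately have "c = 0" by (meson not_le)
    then show ?thesis by (simp add: c_def)
  qed simp
  then show ?thesis by blast
qed

text \<open>\<open>adjoint\<close> is defined by a choice operator, so the identity rests on the
  existence of some adjoint; Riesz representation of x -> (B x, y) supplies its value at each
  y.\<close>

lemma inner_adjoint:
  fixes B :: "'a::{real_inner,complete_space} \<Rightarrow>\<^sub>L 'b::real_inner"
  shows "B x \<bullet> y = x \<bullet> adjoint B y"
proof -
  have "\<exists>z. \<forall>x. B x \<bullet> y = x \<bullet> z" for y
    by (rule riesz_representation) (intro bounded_linear_intros)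
  then have "\<exists>f'. \<forall>x y. B x \<bullet> y = x \<bullet> f' y" by metis
  then show ?thesis unfolding adjoint_def by (rule someI2_ex) blast
qed

lemma bounded_linear_adjoint:
  fixes B :: "'a::{real_inner,complete_space} \<Rightarrow>\<^sub>L 'b::real_inner"
  shows "bounded_linear (adjoint B)"
proof (rule bounded_linear_intro)
  show "adjoint B (x + y) = adjoint B x + adjoint B y" for x y
    by (subst vector_eq_ldot[symmetric]) (simp add: inner_add_right flip: inner_adjoint)
  show "adjoint B (r *\<^sub>R x) = r *\<^sub>R adjoint B x" for r x
    by (subst vector_eq_ldot[symmetric]) (simp flip: inner_adjoint)
  show "norm (adjoint B x) \<le> norm x * norm B" for x
  proof -
    have "norm (adjoint B x) * norm (adjoint B x) = B (adjoint B x) \<bullet> x"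
      by (simp add: inner_adjoint flip: power2_norm_eq_inner power2_eq_square)
    also have "\<dots> \<le> norm (B (adjoint B x)) * norm x"
      by (rule norm_cauchy_schwarz)
    also have "\<dots> \<le> norm B * norm (adjoint B x) * norm x"
      by (intro mult_right_mono norm_blinfun norm_ge_zero)
    finally have "norm (adjoint B x) * norm (adjoint B x) \<le> (norm x * norm B) * norm (adjoint B x)"
      by (simp add: ac_simps)
    then show ?thesis
      by (cases "norm (adjoint B x) = 0") (auto dest: mult_right_le_imp_le)
  qed
qed

section \<open>Bounded C0-semigroups: joint continuity, differentiable orbits, dense domain\<close>

lemma has_vector_derivative_within_iff:
  "(f has_vector_derivative D) (at t within A) \<longleftrightarrow>
    ((\<lambda>s. (f s - f t) /\<^sub>R (s - t)) \<longlongrightarrow> D) (at t within A)"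
proof -
  have "norm ((f s - f t) - (s - t) *\<^sub>R D) / norm (s - t) = norm ((f s - f t) /\<^sub>R (s - t) - D)"
    if "s \<noteq> t" for s
  proof -
    have "(f s - f t) /\<^sub>R (s - t) - D = ((f s - f t) - (s - t) *\<^sub>R D) /\<^sub>R (s - t)"
      using that by (simp add: scaleR_diff_right)
    then show ?thesis by (simp add: divide_inverse mult.commute)
  qed
  then have "((\<lambda>s. norm ((f s - f t) - (s - t) *\<^sub>R D) / norm (s - t)) \<longlongrightarrow> 0) (at t within A) \<longleftrightarrow>
      ((\<lambda>s. norm ((f s - f t) /\<^sub>R (s - t) - D)) \<longlongrightarrow> 0) (at t within A)"
    by (intro Lim_cong_within) auto
  then show ?thesis
    by (simp add: has_vector_derivative_def has_derivative_iff_norm bounded_linear_scaleR_left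
        tendsto_norm_zero_iff LIM_zero_iff)
qed

locale bounded_semigroup =
  fixes S :: "real \<Rightarrow> 'h::{real_inner,banach,second_countable_topology} \<Rightarrow>\<^sub>L 'h" and M :: real
  assumes C0: "C0_semigroup S"
    and bound: "t \<ge> 0 \<Longrightarrow> norm (S t x) \<le> M * norm x"
    and M_nonneg: "M \<ge> 0"
begin

text \<open>\<open>S\<close> is unconstrained at negative times. Clamping the time at 0 gives a map
  that is jointly continuous on all times and vectors and bounded by M, so integrands like
  \<open>flow (t - s) (f s)\<close> are measurable and dominated without restricting s.\<close>

definition flow :: "real \<Rightarrow> 'h \<Rightarrow> 'h" where
  "flow t x = S (max 0 t) x"

lemma flow_0 [simp]: "t \<le> 0 \<Longrightarrow> flow t x = x"
  using C0 by (simp add: flow_def C0_semigroup_def max_def)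

lemma flow_add: "s \<ge> 0 \<Longrightarrow> t \<ge> 0 \<Longrightarrow> flow (s + t) x = flow s (flow t x)"
  using C0 by (simp add: flow_def C0_semigroup_def)

lemma norm_flow: "norm (flow t x) \<le> M * norm x"
  by (simp add: flow_def bound)

lemma bounded_linear_flow: "bounded_linear (flow t)"
  unfolding flow_def by (rule blinfun.bounded_linear_right)

lemma flow_diff: "flow t (x - y) = flow t x - flow t y"
  by (simp add: flow_def blinfun.diff_right)

lemma flow_scaleR: "flow t (c *\<^sub>R x) = c *\<^sub>R flow t x"
  by (simp add: flow_def blinfun.scaleR_right)

lemma tendsto_flow_at_0: "((\<lambda>t. flow t x) \<longlongrightarrow> x) (nhds 0)"
proof -
  have "((\<lambda>t. flow t x) \<longlongrightarrow> x) (at_right 0)"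
  proof (rule Lim_transform_eventually)
    show "((\<lambda>t. S t x) \<longlongrightarrow> x) (at_right 0)" using C0 by (simp add: C0_semigroup_def)
    show "\<forall>\<^sub>F t in at_right 0. S t x = flow t x" by (simp add: eventually_at_filter flow_def)
  qed
  moreover have "((\<lambda>t. flow t x) \<longlongrightarrow> x) (at_left 0)"
    by (rule Lim_transform_eventually[OF tendsto_const]) (simp add: eventually_at_filter)
  ultimately have "((\<lambda>t. flow t x) \<longlongrightarrow> x) (at 0)"
    by (simp add: filterlim_split_at)
  then show ?thesis using tendsto_at_iff_tendsto_nhds[of "\<lambda>t. flow t x" 0] by simp
qed

text \<open>Factoring the later of two times through the earlier one reduces a time increment
  anywhere to an increment at 0, where strong continuity applies; the uniform bound M controls this
  reduction and the change of the vector.\<close>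

lemma tendsto_flow:
  assumes a: "(a \<longlongrightarrow> t) F" and g: "(g \<longlongrightarrow> x) F"
  shows "((\<lambda>i. flow (a i) (g i)) \<longlongrightarrow> flow t x) F"
proof -
  have dist: "norm (flow s x - flow t x) \<le> M * norm (flow \<bar>max 0 s - max 0 t\<bar> x - x)" for s
  proof -
    have main: "norm (flow s x - flow t x) \<le> M * norm (flow (s - t) x - x)" if "s \<ge> t" "t \<ge> 0" for s t
      using flow_add[of t "s - t" x] that norm_flow[of t "flow (s - t) x - x"] by (simp add: flow_diff)
    have "norm (flow s x - flow t x) \<le> M * norm (flow \<bar>s - t\<bar> x - x)" if "s \<ge> 0" "t \<ge> 0" for s t
      using main[of s t] main[of t s] that by (cases "s \<ge> t") (simp_all add: norm_minus_commute)
    from this[of "max 0 s" "max 0 t"] show ?thesis by (simp add: flow_def)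
  qed
  have "((\<lambda>i. \<bar>max 0 (a i) - max 0 t\<bar>) \<longlongrightarrow> \<bar>max 0 t - max 0 t\<bar>) F"
    by (intro tendsto_intros a)
  then have "filterlim (\<lambda>i. \<bar>max 0 (a i) - max 0 t\<bar>) (nhds 0) F" by simp
  from filterlim_compose[OF tendsto_flow_at_0 this]
  have "((\<lambda>i. flow \<bar>max 0 (a i) - max 0 t\<bar> x) \<longlongrightarrow> x) F" .
  then have lim: "((\<lambda>i. M * norm (g i - x) + M * norm (flow \<bar>max 0 (a i) - max 0 t\<bar> x - x))
      \<longlongrightarrow> M * norm (x - x) + M * norm (x - x)) F"
    by (intro tendsto_intros g)
  have le: "norm (flow (a i) (g i) - flow t x)
      \<le> M * norm (g i - x) + M * norm (flow \<bar>max 0 (a i) - max 0 t\<bar> x - x)" for i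
  proof -
    have eq: "flow (a i) (g i) - flow t x = flow (a i) (g i - x) + (flow (a i) x - flow t x)"
      by (simp add: flow_diff)
    show ?thesis unfolding eq
      using norm_triangle_ineq[of "flow (a i) (g i - x)" "flow (a i) x - flow t x"]
        norm_flow[of "a i" "g i - x"] dist[of "a i"] by linarith
  qed
  have "((\<lambda>i. flow (a i) (g i) - flow t x) \<longlongrightarrow> 0) F"
  proof (rule Lim_null_comparison)
    show "\<forall>\<^sub>F i in F. norm (flow (a i) (g i) - flow t x)
      \<le> M * norm (g i - x) + M * norm (flow \<bar>max 0 (a i) - max 0 t\<bar> x - x)"
      by (intro always_eventually allI le)
    show "((\<lambda>i. M * norm (g i - x) + M * norm (flow \<bar>max 0 (a i) - max 0 t\<bar> x - x)) \<longlongrightarrow> 0) F"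
      using lim unfolding diff_self norm_zero mult_zero_right add_0 .
  qed
  then show ?thesis by (rule LIM_zero_cancel)
qed

lemma continuous_on_flow [continuous_intros]:
  "continuous_on X a \<Longrightarrow> continuous_on X g \<Longrightarrow> continuous_on X (\<lambda>s. flow (a s) (g s))"
  unfolding continuous_on_def by (blast intro: tendsto_flow)

lemma borel_measurable_flow [measurable]:
  assumes [measurable]: "a \<in> borel_measurable N" "g \<in> borel_measurable N"
  shows "(\<lambda>s. flow (a s) (g s)) \<in> borel_measurable N"
proof -
  have "continuous_on UNIV (\<lambda>p. flow (fst p) (snd p))"
    by (intro continuous_intros)
  from borel_measurable_continuous_onI[OF this, THEN measurable_compose[of "\<lambda>s. (a s, g s)" N, rotated]]
  show ?thesis by (simp add: borel_prod[symmetric])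
qed

text \<open>The flow commutes with the difference quotients. Orbits of domain vectors thus stay in
  the domain, and a law stated on the domain holds along the whole orbit.\<close>

lemma generator_flow:
  assumes "(x, z) \<in> generator S"
  shows "(flow t x, flow t z) \<in> generator S"
proof -
  have "((\<lambda>r. flow t ((1 / r) *\<^sub>R (S r x - x))) \<longlongrightarrow> flow t z) (at_right 0)"
    using assms by (intro bounded_linear.tendsto[OF bounded_linear_flow]) (simp add: generator_def)
  moreover have "flow t ((1 / r) *\<^sub>R (S r x - x)) = (1 / r) *\<^sub>R (S r (flow t x) - flow t x)" if "r > 0" for r
  proof -
    have "flow t (flow r x) = flow r (flow t x)"
      using flow_add[of "max 0 t" r x] flow_add[of r "max 0 t" x] that
      by (simp add: flow_def add.commute)
    then show ?thesis using that by (simp add: flow_scaleR flow_diff) (simp add: flow_def)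
  qed
  then have "\<forall>\<^sub>F r in at_right 0. flow t ((1 / r) *\<^sub>R (S r x - x)) = (1 / r) *\<^sub>R (S r (flow t x) - flow t x)"
    by (intro eventually_mono[OF eventually_at_right_less[of 0]])
  ultimately show ?thesis
    unfolding generator_def mem_Collect_eq split by (rule Lim_transform_eventually)
qed

lemma flow_has_vector_derivative:
  assumes "(x, z) \<in> generator S" "t \<ge> 0"
  shows "((\<lambda>t. flow t x) has_vector_derivative flow t z) (at t within {0..})"
proof -
  \<comment> \<open>The value z for r <= 0 makes D continuous at 0. Taking the earlier time
    \<open>min s t\<close> as base point, one expression, the flow of D |s - t|, describes the
    quotients from the right and from the left, and joint continuity gives the limit.\<close>
  define D where "D r = (if r > 0 then (1 / r) *\<^sub>R (flow r x - x) else z)" for r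
  have "(D \<longlongrightarrow> z) (at_right 0)"
  proof (rule Lim_transform_eventually)
    show "((\<lambda>t. (1 / t) *\<^sub>R (S t x - x)) \<longlongrightarrow> z) (at_right 0)" using assms(1) by (simp add: generator_def)
    show "\<forall>\<^sub>F t in at_right 0. (1 / t) *\<^sub>R (S t x - x) = D t"
      by (simp add: eventually_at_filter flow_def D_def)
  qed
  moreover have "(D \<longlongrightarrow> z) (at_left 0)"
    by (rule Lim_transform_eventually[OF tendsto_const]) (simp add: eventually_at_filter D_def)
  ultimately have "(D \<longlongrightarrow> z) (at 0)"
    by (simp add: filterlim_split_at)
  then have D: "(D \<longlongrightarrow> z) (nhds 0)"
    using tendsto_at_iff_tendsto_nhds[of D 0] by (simp add: D_def)
  have "((\<lambda>s. \<bar>s - t\<bar>) \<longlongrightarrow> \<bar>t - t\<bar>) (at t within {0..})"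
    by (intro tendsto_intros)
  then have "((\<lambda>s. D \<bar>s - t\<bar>) \<longlongrightarrow> z) (at t within {0..})"
    using filterlim_compose[OF D] by simp
  moreover have "((\<lambda>s. min s t) \<longlongrightarrow> min t t) (at t within {0..})"
    by (intro tendsto_intros)
  ultimately have "((\<lambda>s. flow (min s t) (D \<bar>s - t\<bar>)) \<longlongrightarrow> flow t z) (at t within {0..})"
    by (intro tendsto_flow) auto
  moreover have "flow (min s t) (D \<bar>s - t\<bar>) = (flow s x - flow t x) /\<^sub>R (s - t)"
    if "s \<ge> 0" "s \<noteq> t" for s
  proof (cases "s > t")
    case True
    then show ?thesis using flow_add[of t "s - t" x] assms(2)
      by (simp add: D_def flow_scaleR flow_diff divide_inverse)
  next
    case False
    then show ?thesis using that flow_add[of s "t - s" x] assms(2)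
      by (simp add: D_def flow_scaleR flow_diff divide_inverse)
        (metis inverse_minus_eq minus_diff_eq scaleR_minus_left scaleR_minus_right)
  qed
  then have "\<forall>\<^sub>F s in at t within {0..}. flow (min s t) (D \<bar>s - t\<bar>) = (flow s x - flow t x) /\<^sub>R (s - t)"
    by (simp add: eventually_at_filter)
  ultimately have "((\<lambda>s. (flow s x - flow t x) /\<^sub>R (s - t)) \<longlongrightarrow> flow t z) (at t within {0..})"
    by (rule Lim_transform_eventually)
  then show ?thesis
    by (simp add: has_vector_derivative_within_iff)
qed

text \<open>The means of an orbit over [0, h] lie in the domain and tend to x as h decreases to 0.
  Flowing by r shifts the window, \<open>S r (Y h) = Y (h + r) - Y r\<close>, so the difference
  quotient of the semigroup at \<open>Y h\<close> is the quotient of the integral function at h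
  minus the one at 0.\<close>

lemma generator_dense: "\<exists>X Z. (\<forall>n. (X n, Z n) \<in> generator S) \<and> X \<longlonglongrightarrow> x"
proof -
  define Y where "Y h = integral {0..h} (\<lambda>s. flow s x)" for h
  have cont: "continuous_on A (\<lambda>s. flow s x)" for A by (intro continuous_intros)
  have Y0: "(Y has_vector_derivative flow h x) (at h within {0..H})" if "0 \<le> h" "h \<le> H" for h H
    unfolding Y_def by (rule integral_has_vector_derivative) (auto intro: cont that)
  have right: "((\<lambda>r. (1 / r) *\<^sub>R (Y (h + r) - Y h)) \<longlongrightarrow> flow h x) (at_right 0)" if "h \<ge> 0" for h
  proof -
    have "((\<lambda>s. (Y s - Y h) /\<^sub>R (s - h)) \<longlongrightarrow> flow h x) (at h within {0..h + 1})"
      using Y0[of h "h + 1"] that by (simp add: has_vector_derivative_within_iff)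
    then have "((\<lambda>s. (Y s - Y h) /\<^sub>R (s - h)) \<longlongrightarrow> flow h x) (at h within {h..h + 1})"
      by (rule tendsto_within_subset) (use that in auto)
    then have "((\<lambda>s. (Y s - Y h) /\<^sub>R (s - h)) \<longlongrightarrow> flow h x) (at_right h)"
      by (simp add: at_within_Icc_at_right)
    then show ?thesis
      by (simp add: at_right_to_0[of h] filterlim_filtermap add.commute divide_inverse)
  qed
  have gen: "(Y h, flow h x - x) \<in> generator S" if "h \<ge> 0" for h
  proof -
    have "((\<lambda>r. (1 / r) *\<^sub>R (Y (h + r) - Y h) - (1 / r) *\<^sub>R (Y (0 + r) - Y 0)) \<longlongrightarrow> flow h x - flow 0 x) (at_right 0)"
      by (intro tendsto_diff right) (auto simp: that)
    moreover have "(1 / r) *\<^sub>R (Y (h + r) - Y h) - (1 / r) *\<^sub>R (Y (0 + r) - Y 0) = (1 / r) *\<^sub>R (S r (Y h) - Y h)"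
      if "r > 0" for r
    proof -
      have "S r (Y h) = integral {0..h} (\<lambda>s. S r (flow s x))"
        unfolding Y_def
        by (subst integral_linear[OF integrable_continuous_interval[OF cont] blinfun.bounded_linear_right, symmetric])
          (simp add: o_def)
      also have "\<dots> = integral {0..h} (\<lambda>s. flow (s + r) x)"
        using flow_add[of r _ x] \<open>r > 0\<close>
        by (intro integral_cong) (simp add: add.commute, simp add: flow_def)
      also have "\<dots> = integral {r..h + r} (\<lambda>s. flow s x)"
        using integral_shift_Icc_real[of 0 h "\<lambda>s. flow s x" r] by (simp add: o_def add.commute)
      also have "\<dots> = Y (h + r) - Y r"
        using Henstock_Kurzweil_Integration.integral_combine[of 0 r "h + r" "\<lambda>s. flow s x"] \<open>r > 0\<close> \<open>h \<ge> 0\<close>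
          integrable_continuous_interval[OF cont] by (simp add: Y_def algebra_simps)
      finally have "S r (Y h) = Y (h + r) - Y r" .
      moreover have "Y 0 = 0" by (simp add: Y_def)
      ultimately show ?thesis by (simp add: scaleR_diff_right)
    qed
    then have "\<forall>\<^sub>F r in at_right 0. (1 / r) *\<^sub>R (Y (h + r) - Y h) - (1 / r) *\<^sub>R (Y (0 + r) - Y 0)
        = (1 / r) *\<^sub>R (S r (Y h) - Y h)"
      by (intro eventually_mono[OF eventually_at_right_less[of 0]])
    ultimately show ?thesis
      unfolding generator_def mem_Collect_eq split flow_0[OF order_refl]
      by (rule Lim_transform_eventually)
  qed
  define X Z where "X n = (1 / inverse (real (Suc n))) *\<^sub>R Y (inverse (real (Suc n)))" 
    and "Z n = (1 / inverse (real (Suc n))) *\<^sub>R (flow (inverse (real (Suc n))) x - x)" for n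
  have "(X n, Z n) \<in> generator S" for n
  proof -
    have "((\<lambda>t. (1 / inverse (real (Suc n))) *\<^sub>R (1 / t) *\<^sub>R (S t (Y (inverse (real (Suc n)))) - Y (inverse (real (Suc n)))))
        \<longlongrightarrow> Z n) (at_right 0)"
      unfolding Z_def using gen[of "inverse (real (Suc n))"]
      by (intro tendsto_scaleR tendsto_const) (simp add: generator_def)
    then show ?thesis unfolding generator_def mem_Collect_eq split X_def
      by (simp add: blinfun.scaleR_right scaleR_diff_right mult.commute)
  qed
  moreover have "X \<longlonglongrightarrow> x"
  proof -
    have "filterlim (\<lambda>n. inverse (real (Suc n))) (at_right 0) sequentially"
      unfolding filterlim_at using LIMSEQ_inverse_real_of_nat by auto
    from filterlim_compose[OF right[OF order_refl] this] show ?thesis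
      by (simp add: X_def[abs_def] Y_def)
  qed
  ultimately show ?thesis by blast
qed

end

section \<open>Integrals over intervals and limits of partition sums\<close>

lemma set_integrable_continuous_lebesgue:
  fixes f :: "real \<Rightarrow> real"
  assumes "continuous_on {a..b} f"
  shows "set_integrable lebesgue {a..b} f"
  using integrable_restrict_space[of "{a..b}" lebesgue f] continuous_imp_integrable_real[OF assms]
  by (simp add: set_integrable_def)

lemma FTC_lebesgue:
  fixes f :: "real \<Rightarrow> real"
  assumes "a \<le> b"
    and "\<And>x. a \<le> x \<Longrightarrow> x \<le> b \<Longrightarrow> (F has_vector_derivative f x) (at x within {a..b})"
    and "continuous_on {a..b} f"
  shows "(LINT x:{a..b}|lebesgue. f x) = F b - F a"
proof -
  have "has_bochner_integral lborel (\<lambda>x. indicator {a..b} x *\<^sub>R f x) (F b - F a)"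
    by (rule has_bochner_integral_FTC_Icc[OF assms])
  then have "integrable lborel (\<lambda>x. indicator {a..b} x *\<^sub>R f x)"
    and eq: "(LINT x|lborel. indicator {a..b} x *\<^sub>R f x) = F b - F a"
    by (simp_all add: has_bochner_integral_iff)
  from integral_completion[OF borel_measurable_integrable[OF this(1)]] show ?thesis
    unfolding set_lebesgue_integral_def eq .
qed

lemma AE_lebesgue_neq: "AE s in lebesgue. s \<noteq> (c::real)"
  by (rule AE_I'[of "{c}"]) (auto simp: negligible_iff_null_sets[symmetric])

text \<open>The increment of E over a cell is the integral of a density that depends on the cell.
  Over a uniform partition the increments telescope to E T - E 0 whatever the mesh, while the
  densities converge pointwise to D under the common bound g; dominated convergence then identifies
  the integral.\<close>

lemma interval_function_eq_integral:
  fixes E D g :: "real \<Rightarrow> real" and k :: "real \<Rightarrow> real \<Rightarrow> real \<Rightarrow> real"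
  assumes T: "T \<ge> 0"
    and k_int: "\<And>a b. 0 \<le> a \<Longrightarrow> a \<le> b \<Longrightarrow> b \<le> T \<Longrightarrow> set_integrable lebesgue {a..b} (k a b)"
    and k_eq: "\<And>a b. 0 \<le> a \<Longrightarrow> a \<le> b \<Longrightarrow> b \<le> T \<Longrightarrow> E b - E a = (LINT s:{a..b}|lebesgue. k a b s)"
    and k_le: "\<And>a b s. 0 \<le> a \<Longrightarrow> a \<le> s \<Longrightarrow> s \<le> b \<Longrightarrow> b \<le> T \<Longrightarrow> \<bar>k a b s\<bar> \<le> g s"
    and g: "set_integrable lebesgue {0..T} g"
    and k_lim: "\<And>a b s. 0 < s \<Longrightarrow> s < T \<Longrightarrow> a \<longlonglongrightarrow> s \<Longrightarrow> b \<longlonglongrightarrow> s \<Longrightarrow> (\<And>n. 0 \<le> a n \<and> a n \<le> s \<and> s \<le> b n)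
        \<Longrightarrow> (\<lambda>n. k (a n) (b n) s) \<longlonglongrightarrow> D s"
    and D: "(\<lambda>s. indicator {0..T} s * D s) \<in> borel_measurable lebesgue"
  shows "set_integrable lebesgue {0..T} D \<and> E T - E 0 = (LINT s:{0..T}|lebesgue. D s)"
    (is "?int \<and> ?eq")
proof -
  have "AE s in lebesgue. s \<in> {0..T} \<longrightarrow> norm (D s) \<le> norm (g s)"
    using AE_lebesgue_neq[of 0] AE_lebesgue_neq[of T]
  proof eventually_elim
    case (elim s)
    show ?case
    proof
      assume "s \<in> {0..T}"
      with elim have s: "0 < s" "s < T" by auto
      \<comment> \<open>Constant sequences in \<open>k_lim\<close> identify D s as the density on
        the degenerate cell at s, so D inherits the bound g.\<close>
      have "D s = k s s s"
        using k_lim[OF s, of "\<lambda>_. s" "\<lambda>_. s"] s by (simp add: LIMSEQ_const_iff)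
      then show "norm (D s) \<le> norm (g s)" using k_le[of s s s] s by simp
    qed
  qed
  with g D have ?int
    by (intro set_integrable_bound[OF g]) (simp_all add: set_borel_measurable_def)
  moreover have ?eq
  \<comment> \<open>Locating a point in the grid divides by the mesh width, which is positive only
    for T > 0.\<close>
  proof (cases "T = 0")
    case True
    have "AE s in lebesgue. indicator {0..T} s * D s = 0"
      using AE_lebesgue_neq[of 0] by (rule AE_mp) (auto simp: True split: split_indicator)
    from integral_cong_AE[OF D _ this] have "(LINT s:{0..T}|lebesgue. D s) = (LINT s|lebesgue. 0)"
      by (simp add: set_lebesgue_integral_def)
    then show ?thesis using True by simp
  next
    case False
    with T have T: "T > 0" by simp
    note of_nat_Suc [simp del]
    define h where "h n = T / Suc n" for n
    have h: "h n > 0" for n using T by (simp add: h_def)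
    have hT: "real (Suc n) * h n = T" for n by (simp add: h_def)
    have grid: "0 \<le> real i * h n \<and> real i * h n \<le> real (Suc i) * h n \<and> real (Suc i) * h n \<le> T"
      if "i < Suc n" for i n
    proof -
      have "real (Suc i) * h n \<le> real (Suc n) * h n"
        using that h[of n] by (intro mult_right_mono) auto
      moreover have "real i * h n \<le> real (Suc i) * h n"
        using h[of n] by (intro mult_right_mono) auto
      moreover have "0 \<le> real i * h n" using h[of n] by simp
      ultimately show ?thesis using hT[of n] by linarith
    qed
    \<comment> \<open>Half-open cells cover [0, T) without overlap, so exactly one summand survives
      at each s there. Replacing closed cells by half-open ones drops a null set.\<close>
    define K where "K n s = (\<Sum>i<Suc n. indicator {real i * h n..<real (Suc i) * h n} s
        * k (real i * h n) (real (Suc i) * h n) s)" for n s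
    have piece: "integrable lebesgue (\<lambda>s. indicator {a..<b} s * k a b s)"
        "(LINT s|lebesgue. indicator {a..<b} s * k a b s) = E b - E a"
      if "0 \<le> a" "a \<le> b" "b \<le> T" for a b
    proof -
      have ae: "AE s in lebesgue. indicator {a..b} s * k a b s = indicator {a..<b} s * k a b s"
        using AE_lebesgue_neq[of b] by (rule AE_mp) (auto split: split_indicator)
      have m: "(\<lambda>s. indicator {a..b} s * k a b s) \<in> borel_measurable lebesgue"
        using k_int[OF that] by (auto simp: set_integrable_def intro: borel_measurable_integrable)
      then have "(\<lambda>s. indicator {a..<b} s * (indicator {a..b} s * k a b s)) \<in> borel_measurable lebesgue"
        by (rule borel_measurable_times[OF borel_measurable_indicator, rotated]) simp
      also have "(\<lambda>s. indicator {a..<b} s * (indicator {a..b} s * k a b s)) = (\<lambda>s. indicator {a..<b} s * k a b s)"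
        by (auto simp: fun_eq_iff split: split_indicator)
      finally have m': "(\<lambda>s. indicator {a..<b} s * k a b s) \<in> borel_measurable lebesgue" .
      show "integrable lebesgue (\<lambda>s. indicator {a..<b} s * k a b s)"
        using integrable_cong_AE[OF m m' ae] k_int[OF that] by (simp add: set_integrable_def)
      show "(LINT s|lebesgue. indicator {a..<b} s * k a b s) = E b - E a"
        using integral_cong_AE[OF m m' ae] k_eq[OF that] by (simp add: set_lebesgue_integral_def)
    qed
    have cell: "integrable lebesgue (\<lambda>s. indicator {real i * h n..<real (Suc i) * h n} s
        * k (real i * h n) (real (Suc i) * h n) s)"
      "(LINT s|lebesgue. indicator {real i * h n..<real (Suc i) * h n} s
        * k (real i * h n) (real (Suc i) * h n) s) = E (real (Suc i) * h n) - E (real i * h n)"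
      if "i < Suc n" for i n
      using grid[OF that] by (blast intro: piece)+
    have K_int: "(LINT s|lebesgue. K n s) = E T - E 0" for n
    proof -
      have "(LINT s|lebesgue. K n s) = (\<Sum>i<Suc n. (LINT s|lebesgue.
          indicator {real i * h n..<real (Suc i) * h n} s * k (real i * h n) (real (Suc i) * h n) s))"
        unfolding K_def by (intro Bochner_Integration.integral_sum cell) auto
      also have "\<dots> = (\<Sum>i<Suc n. E (real (Suc i) * h n) - E (real i * h n))"
        by (intro sum.cong cell) auto
      also have "\<dots> = E T - E 0"
        using sum_lessThan_telescope[of "\<lambda>i. E (real i * h n)" "Suc n"] hT[of n] by simp
      finally show ?thesis .
    qed
    have K_meas: "K n \<in> borel_measurable lebesgue" for n
      unfolding K_def by (intro borel_measurable_integrable Bochner_Integration.integrable_sum cell) auto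
    \<comment> \<open>Index of the cell containing s >= 0; it is below n + 1 exactly when s <
      T.\<close>
    define j where "j n s = nat \<lfloor>s / h n\<rfloor>" for n s
    have j: "0 \<le> real (j n s) * h n \<and> real (j n s) * h n \<le> s \<and> s < real (Suc (j n s)) * h n" if "0 \<le> s" for n s
    proof -
      have "real (j n s) = of_int \<lfloor>s / h n\<rfloor>"
        using that h[of n] by (simp add: j_def)
      then have "real (j n s) \<le> s / h n" "s / h n < real (j n s) + 1" by linarith+
      then show ?thesis using h[of n] by (auto simp: field_simps of_nat_Suc)
    qed
    have K_eq: "K n s = (if s < T then k (real (j n s) * h n) (real (Suc (j n s)) * h n) s else 0)"
      if "0 \<le> s" for n s
    proof -
      have "indicator {real i * h n..<real (Suc i) * h n} s = (if i = j n s then 1 else (0::real))" for i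
      proof -
        have "real i * h n \<le> s \<and> s < real (Suc i) * h n \<longleftrightarrow> i = j n s"
        proof
          assume a: "real i * h n \<le> s \<and> s < real (Suc i) * h n"
          then have "real i * h n < real (Suc (j n s)) * h n" "real (j n s) * h n < real (Suc i) * h n"
            using j[OF that, of n] by linarith+
          then show "i = j n s" using h[of n] by (simp add: mult_less_cancel_right)
        qed (use j[OF that] in auto)
        then show ?thesis by (auto split: split_indicator)
      qed
      then have "K n s = (\<Sum>i<Suc n. if i = j n s then k (real i * h n) (real (Suc i) * h n) s else 0)"
        unfolding K_def by (intro sum.cong) auto
      also have "\<dots> = (if j n s < Suc n then k (real (j n s) * h n) (real (Suc (j n s)) * h n) s else 0)"
        by (subst sum.delta) auto
      also have "j n s < Suc n \<longleftrightarrow> s < T"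
      proof
        assume "j n s < Suc n"
        then show "s < T" using grid[of "j n s" n] j[OF that, of n] by linarith
      next
        assume "s < T"
        then have "real (j n s) * h n < real (Suc n) * h n" using j[OF that, of n] hT[of n] by linarith
        then show "j n s < Suc n" using h[of n] by (simp add: mult_less_cancel_right)
      qed
      finally show ?thesis .
    qed
    have jT: "real (Suc (j n s)) * h n \<le> T" if "0 \<le> s" "s < T" for n s
    proof -
      have "real (j n s) * h n < real (Suc n) * h n" using j[OF that(1), of n] hT[of n] that by linarith
      then have "j n s < Suc n" using h[of n] by (simp add: mult_less_cancel_right)
      then show ?thesis using grid by blast
    qed
    have K_neg: "K n s = 0" if "s < 0" for n s
    proof -
      have "\<not> real i * h n \<le> s" for i using that h[of n] by (smt (verit) mult_nonneg_nonneg of_nat_0_le_iff)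
      then show ?thesis by (simp add: K_def)
    qed
    have h0: "h \<longlonglongrightarrow> 0"
      unfolding h_def using LIMSEQ_Suc[OF lim_const_over_n[of T]] by simp
    have "(\<lambda>n. LINT s|lebesgue. K n s) \<longlonglongrightarrow> (LINT s|lebesgue. indicator {0..T} s * D s)"
    proof (rule integral_dominated_convergence)
      show "integrable lebesgue (\<lambda>s. indicator {0..T} s * g s)"
        using g by (simp add: set_integrable_def)
      show "AE s in lebesgue. norm (K n s) \<le> indicator {0..T} s * g s" for n
      proof (rule AE_I2)
        fix s
        have g0: "0 \<le> g s" if "0 \<le> s" "s \<le> T" using k_le[of s s s] that by force
        consider "s < 0" | "0 \<le> s" "s < T" | "T \<le> s" "0 \<le> s" using T by linarith
        then show "norm (K n s) \<le> indicator {0..T} s * g s"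
        proof cases
          case 2
          then show ?thesis using j[of s n] jT[of s n] k_le[of "real (j n s) * h n" s "real (Suc (j n s)) * h n"]
            by (simp add: K_eq)
        qed (use T g0 in \<open>auto simp: K_neg K_eq split: split_indicator\<close>)
      qed
      show "AE s in lebesgue. (\<lambda>n. K n s) \<longlonglongrightarrow> indicator {0..T} s * D s"
        using AE_lebesgue_neq[of 0] AE_lebesgue_neq[of T]
      proof eventually_elim
        case (elim s)
        consider "s < 0" | "0 < s" "s < T" | "T < s" using elim by linarith
        then show ?case
        proof cases
          case 2
          have a: "(\<lambda>n. real (j n s) * h n) \<longlonglongrightarrow> s"
          proof (rule tendsto_sandwich[of "\<lambda>n. s - h n" _ _ "\<lambda>n. s"])
            show "(\<lambda>n. s - h n) \<longlonglongrightarrow> s" using tendsto_diff[OF tendsto_const h0] by simp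
            have "s - h n \<le> real (j n s) * h n" for n
              using j[of s n] 2 by (simp add: algebra_simps of_nat_Suc)
            then show "\<forall>\<^sub>F n in sequentially. s - h n \<le> real (j n s) * h n" by simp
          qed (use j[of s] 2 in auto)
          moreover from tendsto_add[OF a h0] have "(\<lambda>n. real (Suc (j n s)) * h n) \<longlonglongrightarrow> s"
            by (simp add: algebra_simps of_nat_Suc)
          ultimately have "(\<lambda>n. k (real (j n s) * h n) (real (Suc (j n s)) * h n) s) \<longlonglongrightarrow> D s"
            using 2 j[of s] by (intro k_lim) (auto intro: less_imp_le)
          then show ?thesis using 2 by (simp add: K_eq)
        qed (use T in \<open>auto simp: K_neg K_eq\<close>)
      qed
    qed (use D K_meas in auto)
    then show ?thesis
      by (simp add: K_int set_lebesgue_integral_def LIMSEQ_const_iff)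
  qed
  ultimately show ?thesis ..
qed

section \<open>Mild solutions: splitting in time and continuity\<close>

lemma measurable_ident_lebesgue [measurable]: "(\<lambda>s::real. s) \<in> borel_measurable lebesgue"
  by (intro measurable_completion) simp

context bounded_semigroup
begin

lemma set_integrable_flow:
  assumes [measurable]: "f \<in> borel_measurable lebesgue" and "set_integrable lebesgue A f"
    and [measurable]: "A \<in> sets lebesgue"
  shows "set_integrable lebesgue A (\<lambda>s. flow (c - s) (f s))"
proof (rule set_integrable_bound)
  show "set_integrable lebesgue A (\<lambda>s. M *\<^sub>R f s)" using assms by simp
  show "set_borel_measurable lebesgue A (\<lambda>s. flow (c - s) (f s))"
    unfolding set_borel_measurable_def by measurable
  show "AE s in lebesgue. s \<in> A \<longrightarrow> norm (flow (c - s) (f s)) \<le> norm (M *\<^sub>R f s)"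
    using norm_flow M_nonneg by simp
qed

definition state :: "(real \<Rightarrow> 'h) \<Rightarrow> real \<Rightarrow> 'h" where
  "state f t = (LINT s:{0..t}|lebesgue. flow (t - s) (f s))"

lemma state_0 [simp]: "state f 0 = 0"
proof -
  have "AE s in lebesgue. indicator {0..0} s *\<^sub>R flow (0 - s) (f s) = 0"
    using AE_lebesgue_neq[of 0] by (rule AE_mp) (auto split: split_indicator)
  then show ?thesis unfolding state_def set_lebesgue_integral_def by (rule integral_eq_zero_AE)
qed

text \<open>The semigroup law restarts the mild solution at time a. What separates the state at b
  from the free evolution of the state at a is the input collected during [a, b] only, which makes
  increments over short cells explicit.\<close>

lemma state_split:
  assumes f: "f \<in> borel_measurable lebesgue" "set_integrable lebesgue {0..b} f" and ab: "0 \<le> a" "a \<le> b"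
  shows "state f b - flow (b - a) (state f a) = (LINT s:{a..b}|lebesgue. flow (b - s) (f s))"
proof -
  have int: "set_integrable lebesgue A (\<lambda>s. flow (c - s) (f s))" if "A \<subseteq> {0..b}" "A \<in> sets lebesgue" for A c
    using that set_integrable_subset[OF f(2) that(2,1)] by (intro set_integrable_flow f)
  have "flow (b - a) (state f a) = (LINT s:{0..a}|lebesgue. flow (b - a) (flow (a - s) (f s)))"
  proof -
    have "integrable lebesgue (\<lambda>s. indicator {0..a} s *\<^sub>R flow (a - s) (f s))"
      using int[of "{0..a}" a] ab by (simp add: set_integrable_def)
    from integral_bounded_linear[OF bounded_linear_flow[of "b - a"] this] show ?thesis
      by (simp add: state_def set_lebesgue_integral_def flow_scaleR)
  qed
  also have "\<dots> = (LINT s:{0..a}|lebesgue. flow (b - s) (f s))"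
  proof (rule set_lebesgue_integral_cong)
    have "flow (b - a) (flow (a - s) (f s)) = flow (b - s) (f s)" if "s \<le> a" for s
      using flow_add[of "b - a" "a - s" "f s"] ab that by simp
    then show "\<forall>s. s \<in> {0..a} \<longrightarrow> flow (b - a) (flow (a - s) (f s)) = flow (b - s) (f s)"
      by simp
  qed simp
  finally have "flow (b - a) (state f a) = (LINT s:{0..a}|lebesgue. flow (b - s) (f s))" .
  moreover have "state f b = (LINT s:{0..a} \<union> {a..b}|lebesgue. flow (b - s) (f s))"
    using ab by (simp add: state_def ivl_disj_un)
  moreover have "(LINT s:{0..a} \<union> {a..b}|lebesgue. flow (b - s) (f s))
      = (LINT s:{0..a}|lebesgue. flow (b - s) (f s)) + (LINT s:{a..b}|lebesgue. flow (b - s) (f s))"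
  proof (rule set_integral_Un_AE)
    show "AE x in lebesgue. \<not> (x \<in> {0..a} \<and> x \<in> {a..b})"
      using AE_lebesgue_neq[of a] by (rule AE_mp) auto
  qed (use ab in \<open>auto intro!: int\<close>)
  ultimately show ?thesis by simp
qed

text \<open>The moving upper limit is put into an indicator, which converges at every s other than
  t. A convergent sequence of times is bounded by some B, and M |f| on [0, B] dominates.\<close>

lemma continuous_on_state:
  assumes f: "f \<in> borel_measurable lebesgue" "\<And>t. set_integrable lebesgue {0..t} f"
  shows "continuous_on {0..} (state f)"
  unfolding continuous_on_sequentially
proof (intro ballI allI impI, elim conjE)
  fix x :: "nat \<Rightarrow> real" and t
  assume x: "\<forall>n. x n \<in> {0..}" "x \<longlonglongrightarrow> t" and t: "t \<in> {0..}"
  obtain B where B: "\<And>n. x n \<le> B"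
    using convergent_imp_Bseq[OF convergentI[OF x(2)]] by (auto simp: Bseq_def abs_le_iff)
  have [measurable]: "f \<in> borel_measurable lebesgue" by (rule f)
  have "(\<lambda>n. LINT s|lebesgue. indicator {0..x n} s *\<^sub>R flow (x n - s) (f s))
      \<longlonglongrightarrow> (LINT s|lebesgue. indicator {0..t} s *\<^sub>R flow (t - s) (f s))"
  proof (rule integral_dominated_convergence)
    show "integrable lebesgue (\<lambda>s. M * norm (indicator {0..B} s *\<^sub>R f s))"
      using f(2)[of B] unfolding set_integrable_def by (intro integrable_mult_right integrable_norm)
    show "AE s in lebesgue. norm (indicator {0..x n} s *\<^sub>R flow (x n - s) (f s)) \<le> M * norm (indicator {0..B} s *\<^sub>R f s)" for n
    proof (rule AE_I2)
      fix s
      show "norm (indicator {0..x n} s *\<^sub>R flow (x n - s) (f s)) \<le> M * norm (indicator {0..B} s *\<^sub>R f s)"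
        using B[of n] norm_flow[of "x n - s" "f s"] M_nonneg by (simp split: split_indicator)
    qed
    show "AE s in lebesgue. (\<lambda>n. indicator {0..x n} s *\<^sub>R flow (x n - s) (f s))
        \<longlonglongrightarrow> indicator {0..t} s *\<^sub>R flow (t - s) (f s)"
      using AE_lebesgue_neq[of t]
    proof eventually_elim
      case (elim s)
      have lim: "(\<lambda>n. flow (x n - s) (f s)) \<longlonglongrightarrow> flow (t - s) (f s)"
        by (intro tendsto_flow tendsto_intros x)
      have "\<forall>\<^sub>F n in sequentially. indicator {0..t} s = (indicator {0..x n} s :: real)"
      proof (cases "s < t")
        case True
        from order_tendstoD(1)[OF x(2) this] show ?thesis
          by eventually_elim (use True in \<open>auto split: split_indicator\<close>)
      next
        case False
        with elim have "t < s" by simp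
        from order_tendstoD(2)[OF x(2) this] show ?thesis
          by eventually_elim (use \<open>t < s\<close> in \<open>auto split: split_indicator\<close>)
      qed
      then have "\<forall>\<^sub>F n in sequentially. indicator {0..t} s *\<^sub>R flow (x n - s) (f s)
          = indicator {0..x n} s *\<^sub>R flow (x n - s) (f s)"
        by eventually_elim simp
      with tendsto_scaleR[OF tendsto_const lim] show ?case
        by (rule Lim_transform_eventually)
    qed
  qed measurable
  then show "(state f \<circ> x) \<longlonglongrightarrow> state f t"
    by (simp add: state_def set_lebesgue_integral_def o_def)
qed

end

section \<open>The energy identity for free and driven trajectories\<close>

text \<open>The dissipation law is asked for only on the domain of the generator, where the Riccati
  equation can be tested with the state; continuity and quadratic growth of q carry it over to all
  of H. Two instances follow: the closed-loop semigroup, and the scalar semigroup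
  \<open>decay\<close> with P the identity.\<close>

locale dissipative_semigroup = bounded_semigroup S M
  for S :: "real \<Rightarrow> 'h::{real_inner,banach,second_countable_topology} \<Rightarrow>\<^sub>L 'h" and M +
  fixes P :: "'h \<Rightarrow>\<^sub>L 'h" and q :: "'h \<Rightarrow> real" and K :: real
  assumes sym: "P x \<bullet> y = x \<bullet> P y"
    and q_cont: "continuous_on UNIV q"
    and q_bound: "\<bar>q x\<bar> \<le> K * (norm x)\<^sup>2"
    and dissipation: "(x, z) \<in> generator S \<Longrightarrow> 2 * (P x \<bullet> z) = - q x"
begin

lemma continuous_on_q [continuous_intros]: "continuous_on A g \<Longrightarrow> continuous_on A (\<lambda>s. q (g s))"
  using continuous_on_compose2[OF q_cont] by blast

lemma q_measurable [measurable]: "q \<in> borel_measurable borel"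
  using q_cont by (rule borel_measurable_continuous_onI)

text \<open>For a domain vector this is the product rule, symmetry of P merging its two terms. In
  general both sides converge along domain vectors tending to x: these are bounded by some B, so
  orbits are bounded by M B and the growth of q gives a constant majorant on [a, b].\<close>

lemma energy_flow:
  assumes "a \<le> b"
  shows "P (flow (b - a) x) \<bullet> flow (b - a) x - P x \<bullet> x = - (LINT s:{a..b}|lebesgue. q (flow (s - a) x))"
proof -
  have dom: "P (flow (b - a) x) \<bullet> flow (b - a) x - P x \<bullet> x = - (LINT s:{a..b}|lebesgue. q (flow (s - a) x))"
    if x: "(x, z) \<in> generator S" for x z
  proof -
    let ?F = "\<lambda>s. P (flow (s - a) x) \<bullet> flow (s - a) x"
    have "(?F has_vector_derivative - q (flow (s - a) x)) (at s within {a..b})" if "a \<le> s" "s \<le> b" for s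
    proof -
      have "((\<lambda>s. s - a) has_vector_derivative 1) (at s within {a..b})"
        by (auto intro!: derivative_eq_intros simp: has_vector_derivative_def)
      moreover have "((\<lambda>t. flow t x) has_vector_derivative flow (s - a) z) (at (s - a) within (\<lambda>s. s - a) ` {a..b})"
        using flow_has_vector_derivative[OF x, of "s - a"] that
        by (auto intro: has_vector_derivative_within_subset)
      ultimately have v: "((\<lambda>s. flow (s - a) x) has_vector_derivative flow (s - a) z) (at s within {a..b})"
        using vector_diff_chain_within[of "\<lambda>s. s - a" 1 s "{a..b}" "\<lambda>t. flow t x"] by (simp add: o_def)
      from bounded_bilinear.has_vector_derivative[OF bounded_bilinear_inner
          bounded_linear.has_vector_derivative[OF blinfun.bounded_linear_right[of P] v] v]
      show ?thesis
        using dissipation[OF generator_flow[OF x, of "s - a"]] sym[of "flow (s - a) z" "flow (s - a) x"]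
        by (simp add: inner_commute)
    qed
    from FTC_lebesgue[OF assms this] have "(LINT s:{a..b}|lebesgue. - q (flow (s - a) x)) = ?F b - ?F a"
      by (simp add: continuous_intros)
    then show ?thesis
      by (simp add: set_lebesgue_integral_def)
  qed
  obtain X Z where X: "\<And>n. (X n, Z n) \<in> generator S" "X \<longlonglongrightarrow> x"
    using generator_dense by blast
  obtain B where B: "\<And>n. norm (X n) \<le> B"
    using convergent_imp_Bseq[OF convergentI[OF X(2)]] by (auto simp: Bseq_def)
  have M2: "\<bar>q (flow t y)\<bar> \<le> \<bar>K\<bar> * (M * B)\<^sup>2" if "norm y \<le> B" for t y
  proof -
    have "norm (flow t y) \<le> M * B"
      using norm_flow[of t y] mult_left_mono[OF that M_nonneg] by linarith
    then have "\<bar>K\<bar> * (norm (flow t y))\<^sup>2 \<le> \<bar>K\<bar> * (M * B)\<^sup>2"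
      by (intro mult_left_mono power_mono) auto
    moreover have "K * (norm (flow t y))\<^sup>2 \<le> \<bar>K\<bar> * (norm (flow t y))\<^sup>2"
      by (intro mult_right_mono) auto
    ultimately show ?thesis using q_bound[of "flow t y"] by linarith
  qed
  have "(\<lambda>n. LINT s|lebesgue. indicator {a..b} s *\<^sub>R q (flow (s - a) (X n)))
      \<longlonglongrightarrow> (LINT s|lebesgue. indicator {a..b} s *\<^sub>R q (flow (s - a) x))"
  proof (rule integral_dominated_convergence)
    show "integrable lebesgue (\<lambda>s. indicator {a..b} s *\<^sub>R (\<bar>K\<bar> * (M * B)\<^sup>2))"
      using set_integrable_continuous_lebesgue[of a b "\<lambda>_. \<bar>K\<bar> * (M * B)\<^sup>2"]
      by (simp add: set_integrable_def)
    show "AE s in lebesgue. (\<lambda>n. indicator {a..b} s *\<^sub>R q (flow (s - a) (X n)))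
        \<longlonglongrightarrow> indicator {a..b} s *\<^sub>R q (flow (s - a) x)"
    proof (rule AE_I2, rule tendsto_scaleR[OF tendsto_const])
      fix s
      have "isCont q (flow (s - a) x)" using q_cont by (simp add: continuous_on_eq_continuous_at)
      then show "(\<lambda>n. q (flow (s - a) (X n))) \<longlonglongrightarrow> q (flow (s - a) x)"
        by (rule isCont_tendsto_compose) (intro tendsto_flow tendsto_const X)
    qed
    show "AE s in lebesgue. norm (indicator {a..b} s *\<^sub>R q (flow (s - a) (X n)))
        \<le> indicator {a..b} s *\<^sub>R (\<bar>K\<bar> * (M * B)\<^sup>2)" for n
      using M2[OF B] by (auto split: split_indicator)
  qed measurable
  then have "(\<lambda>n. - (LINT s:{a..b}|lebesgue. q (flow (s - a) (X n)))) \<longlonglongrightarrow> - (LINT s:{a..b}|lebesgue. q (flow (s - a) x))"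
    unfolding set_lebesgue_integral_def by (rule tendsto_minus)
  moreover have "(\<lambda>n. P (flow (b - a) (X n)) \<bullet> flow (b - a) (X n) - P (X n) \<bullet> X n)
      \<longlonglongrightarrow> P (flow (b - a) x) \<bullet> flow (b - a) x - P x \<bullet> x"
    by (intro tendsto_intros tendsto_flow X)
  ultimately show ?thesis
    using LIMSEQ_unique unfolding dom[OF X(1)] by blast
qed

theorem energy_state:
  assumes f: "f \<in> borel_measurable lebesgue" "\<And>t. set_integrable lebesgue {0..t} f" and T: "T \<ge> 0"
  shows "P (state f T) \<bullet> state f T
      = (LINT s:{0..T}|lebesgue. 2 * (P (state f s) \<bullet> f s) - q (state f s))" (is ?eq)
    and "set_integrable lebesgue {0..T} (\<lambda>s. 2 * (P (state f s) \<bullet> f s) - q (state f s))" (is ?int)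
proof -
  let ?y = "state f"
  \<comment> \<open>The first term pairs the transported input with P applied to the sum of the true
    and the freely evolved state; the second is the dissipation along the free flow. As the cell
    shrinks to s, that sum tends to twice the state, which is the origin of the factor 2 in the
    limiting rate.\<close>
  define k where "k a b s = P (?y b + flow (b - a) (?y a)) \<bullet> flow (b - s) (f s) - q (flow (s - a) (?y a))" for a b s
  have y_cont: "continuous_on {0..} ?y" by (rule continuous_on_state[OF f])
  have "compact (?y ` {0..T})"
    by (intro compact_continuous_image continuous_on_subset[OF y_cont]) auto
  then obtain Y where "\<forall>y\<in>?y ` {0..T}. norm y \<le> Y"
    using compact_imp_bounded bounded_iff by metis
  then have Y: "norm (?y t) \<le> Y" if "0 \<le> t" "t \<le> T" for t using that by auto
  have flow_le: "norm (flow c x) \<le> M * Z" if "norm x \<le> Z" for c x Z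
    using norm_flow[of c x] mult_left_mono[OF that M_nonneg] by linarith
  \<comment> \<open>Y bounds the state on [0, T] and M Y its free evolutions, uniformly over all
    cells. Only |f s| remains variable, so local integrability of f makes this majorant
    integrable.\<close>
  define g where "g s = norm P * (Y + M * Y) * (M * norm (f s)) + \<bar>K\<bar> * (M * Y)\<^sup>2" for s
  have int_flow: "set_integrable lebesgue {a..b} (\<lambda>s. flow (b - s) (f s))" if "0 \<le> a" for a b
    using that by (intro set_integrable_flow f set_integrable_subset[OF f(2)[of b]]) auto
  have int_inner: "set_integrable lebesgue {a..b} (\<lambda>s. x \<bullet> flow (b - s) (f s))"
    "(LINT s:{a..b}|lebesgue. x \<bullet> flow (b - s) (f s)) = x \<bullet> (LINT s:{a..b}|lebesgue. flow (b - s) (f s))"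
    if "0 \<le> a" for a b x
    using integrable_inner_right[of x lebesgue "\<lambda>s. indicator {a..b} s *\<^sub>R flow (b - s) (f s)"]
      integral_inner_right[of x lebesgue "\<lambda>s. indicator {a..b} s *\<^sub>R flow (b - s) (f s)"] int_flow[OF that]
    by (simp_all add: set_integrable_def set_lebesgue_integral_def)
  have int_q: "set_integrable lebesgue {a..b} (\<lambda>s. q (flow (s - a) x))" for a b x
    by (intro set_integrable_continuous_lebesgue continuous_intros)
  have "?int \<and> P (?y T) \<bullet> ?y T - P (?y 0) \<bullet> ?y 0
      = (LINT s:{0..T}|lebesgue. 2 * (P (?y s) \<bullet> f s) - q (?y s))"
  proof (rule interval_function_eq_integral[where k = k and g = g, OF T])
    fix a b :: real assume ab: "0 \<le> a" "a \<le> b" "b \<le> T"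
    show "set_integrable lebesgue {a..b} (k a b)"
      unfolding k_def using ab by (intro set_integral_diff int_inner int_q)
    have "P (?y b) \<bullet> ?y b - P (?y a) \<bullet> ?y a
      = P (?y b + flow (b - a) (?y a)) \<bullet> (?y b - flow (b - a) (?y a))
        + (P (flow (b - a) (?y a)) \<bullet> flow (b - a) (?y a) - P (?y a) \<bullet> ?y a)"
      using sym[of "?y b" "flow (b - a) (?y a)"]
      by (simp add: blinfun.add_right inner_simps inner_commute)
    also have "\<dots> = (LINT s:{a..b}|lebesgue. P (?y b + flow (b - a) (?y a)) \<bullet> flow (b - s) (f s))
        - (LINT s:{a..b}|lebesgue. q (flow (s - a) (?y a)))"
      using ab by (simp add: state_split[OF f] energy_flow int_inner)
    also have "\<dots> = (LINT s:{a..b}|lebesgue. k a b s)"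
      unfolding k_def using ab by (intro set_integral_diff(2)[symmetric] int_inner int_q)
    finally show "P (?y b) \<bullet> ?y b - P (?y a) \<bullet> ?y a = (LINT s:{a..b}|lebesgue. k a b s)" .
  next
    fix a b s :: real assume s: "0 \<le> a" "a \<le> s" "s \<le> b" "b \<le> T"
    have "norm (?y b + flow (b - a) (?y a)) \<le> Y + M * Y"
      using s by (intro norm_triangle_mono flow_le Y) auto
    then have "norm (P (?y b + flow (b - a) (?y a))) \<le> norm P * (Y + M * Y)"
      using norm_blinfun[of P "?y b + flow (b - a) (?y a)"] mult_left_mono[OF _ norm_ge_zero[of P]]
      by (meson order_trans)
    then have "\<bar>P (?y b + flow (b - a) (?y a)) \<bullet> flow (b - s) (f s)\<bar> \<le> norm P * (Y + M * Y) * (M * norm (f s))"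
      using Cauchy_Schwarz_ineq2[of "P (?y b + flow (b - a) (?y a))" "flow (b - s) (f s)"]
        mult_mono[OF _ norm_flow[of "b - s" "f s"]] norm_ge_zero order_trans by meson
    moreover have "\<bar>q (flow (s - a) (?y a))\<bar> \<le> \<bar>K\<bar> * (M * Y)\<^sup>2"
    proof -
      have "\<bar>K\<bar> * (norm (flow (s - a) (?y a)))\<^sup>2 \<le> \<bar>K\<bar> * (M * Y)\<^sup>2"
        using s by (intro mult_left_mono power_mono flow_le Y) auto
      moreover have "K * (norm (flow (s - a) (?y a)))\<^sup>2 \<le> \<bar>K\<bar> * (norm (flow (s - a) (?y a)))\<^sup>2"
        by (intro mult_right_mono) auto
      ultimately show ?thesis using q_bound[of "flow (s - a) (?y a)"] by linarith
    qed
    ultimately show "\<bar>k a b s\<bar> \<le> g s" unfolding k_def g_def by linarith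
  next
    show "set_integrable lebesgue {0..T} g"
      unfolding g_def using f(2)[of T]
      by (intro set_integral_add set_integrable_mult_right set_integrable_norm
          set_integrable_continuous_lebesgue) auto
  next
    fix a b :: "nat \<Rightarrow> real" and s
    assume s: "0 < s" "s < T" "a \<longlonglongrightarrow> s" "b \<longlonglongrightarrow> s" "\<And>n. 0 \<le> a n \<and> a n \<le> s \<and> s \<le> b n"
    have y_lim: "(\<lambda>n. ?y (c n)) \<longlonglongrightarrow> ?y s" if "c \<longlonglongrightarrow> s" "\<And>n. 0 \<le> c n" for c
      using that s y_cont by (auto simp: continuous_on_sequentially o_def)
    have b0: "0 \<le> b n" for n using s(1) s(5)[of n] by linarith
    have isq: "isCont q x" for x using q_cont by (simp add: continuous_on_eq_continuous_at)
    have "(\<lambda>n. k (a n) (b n) s) \<longlonglongrightarrow> P (?y s + flow (s - s) (?y s)) \<bullet> flow (s - s) (f s) - q (flow (s - s) (?y s))"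
      unfolding k_def using s(5)
      by (intro tendsto_intros tendsto_flow y_lim s isCont_tendsto_compose[OF isq] b0) auto
    then show "(\<lambda>n. k (a n) (b n) s) \<longlonglongrightarrow> 2 * (P (?y s) \<bullet> f s) - q (?y s)"
      by (simp add: blinfun.add_right inner_simps)
  next
    \<comment> \<open>Continuity of the state is known on nonnegative times only; the truncation
      agrees with it on [0, T] and is Borel measurable on the whole line.\<close>
    define y' where "y' s = indicator {0..T} s *\<^sub>R ?y s" for s
    have "y' \<in> borel_measurable borel" unfolding y'_def
      by (intro borel_measurable_continuous_on_indicator continuous_on_subset[OF y_cont]) auto
    then have [measurable]: "y' \<in> borel_measurable lebesgue" by (intro measurable_completion) simp
    have [measurable]: "f \<in> borel_measurable lebesgue" by (rule f)
    have [measurable]: "blinfun_apply P \<in> borel_measurable borel"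
      by (intro borel_measurable_continuous_onI continuous_intros)
    have "(\<lambda>s. indicator {0..T} s * (2 * (P (y' s) \<bullet> f s) - q (y' s))) \<in> borel_measurable lebesgue"
      by measurable
    also have "(\<lambda>s. indicator {0..T} s * (2 * (P (y' s) \<bullet> f s) - q (y' s)))
        = (\<lambda>s. indicator {0..T} s * (2 * (P (?y s) \<bullet> f s) - q (?y s)))"
      by (auto simp: y'_def fun_eq_iff split: split_indicator)
    finally show "(\<lambda>s. indicator {0..T} s * (2 * (P (?y s) \<bullet> f s) - q (?y s))) \<in> borel_measurable lebesgue" .
  qed
  then show ?eq ?int by simp_all
qed

end

section \<open>Square-integrability of the state by a scalar comparison\<close>

lemma set_integrable_of_square:
  fixes f :: "real \<Rightarrow> 'a::{banach,second_countable_topology}"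
  assumes [measurable]: "f \<in> borel_measurable lebesgue"
    and sq: "set_integrable lebesgue {a..b} (\<lambda>s. (norm (f s))\<^sup>2)"
  shows "set_integrable lebesgue {a..b} f"
proof (rule set_integrable_bound)
  show "set_integrable lebesgue {a..b} (\<lambda>s. 1 + (norm (f s))\<^sup>2)"
    by (intro set_integral_add sq set_integrable_continuous_lebesgue) auto
  show "set_borel_measurable lebesgue {a..b} f"
    unfolding set_borel_measurable_def by measurable
  have "norm (f s) \<le> 1 + (norm (f s))\<^sup>2" for s
    using self_le_power[of "norm (f s)" 2] by (cases "1 \<le> norm (f s)") (auto intro: add_increasing2)
  then show "AE s in lebesgue. s \<in> {a..b} \<longrightarrow> norm (f s) \<le> norm (1 + (norm (f s))\<^sup>2)"
    by simp
qed

text \<open>The equation x' = -\<alpha> x as a semigroup of bounded operators on the reals, so that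
  the abstract energy identity also applies to a scalar comparison equation.\<close>

definition decay :: "real \<Rightarrow> real \<Rightarrow> real \<Rightarrow>\<^sub>L real" where
  "decay \<alpha> t = exp (- \<alpha> * t) *\<^sub>R id_blinfun"

lemma decay_apply [simp]: "decay \<alpha> t x = exp (- \<alpha> * t) * x"
  by (simp add: decay_def blinfun.scaleR_left)

lemma dissipative_decay:
  assumes "\<alpha> > 0"
  shows "dissipative_semigroup (decay \<alpha>) 1 id_blinfun (\<lambda>x. 2 * \<alpha> * x\<^sup>2) (2 * \<alpha>)"
proof
  have lim: "((\<lambda>t. (1 / t) *\<^sub>R (exp (- \<alpha> * t) * x - x)) \<longlongrightarrow> - \<alpha> * x) (at_right 0)" for x
  proof -
    have "((\<lambda>t. exp (- \<alpha> * t) * x) has_field_derivative - \<alpha> * x) (at 0 within {0<..})"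
      by (auto intro!: derivative_eq_intros)
    then show ?thesis by (simp add: has_field_derivative_iff divide_inverse mult.commute)
  qed
  have "((\<lambda>t. decay \<alpha> t x) \<longlongrightarrow> decay \<alpha> 0 x) (at_right 0)" for x
    unfolding decay_apply by (intro tendsto_intros)
  moreover have "decay \<alpha> 0 = id_blinfun" by (simp add: decay_def)
  moreover have "decay \<alpha> (s + t) = decay \<alpha> s o\<^sub>L decay \<alpha> t" for s t
    by (rule blinfun_eqI) (simp add: distrib_left flip: exp_add)
  ultimately show "C0_semigroup (decay \<alpha>)"
    by (simp add: C0_semigroup_def)
  show "norm (decay \<alpha> t x) \<le> 1 * norm x" if "t \<ge> 0" for t x
  proof -
    have "exp (- \<alpha> * t) \<le> 1" using that assms by simp
    from mult_right_mono[OF this abs_ge_zero[of x]] show ?thesis by (simp add: abs_mult)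
  qed
  show "2 * (id_blinfun x \<bullet> z) = - (2 * \<alpha> * x\<^sup>2)" if "(x, z) \<in> generator (decay \<alpha>)" for x z :: real
  proof -
    have "((\<lambda>t. (1 / t) *\<^sub>R (exp (- \<alpha> * t) * x - x)) \<longlongrightarrow> z) (at_right 0)"
      using that by (simp add: generator_def)
    from tendsto_unique[OF _ this lim] have "z = - \<alpha> * x" by simp
    then show ?thesis by (simp add: power2_eq_square)
  qed
qed (use assms in \<open>auto intro!: continuous_intros\<close>)

context bounded_semigroup
begin

text \<open>The norm of the state is at most M r, where r is the mild solution of r' = -\<alpha> r +
  |f| with r(0) = 0. The energy identity for r^2 replaces a convolution inequality: since 2 r |f| <=
  \<alpha> r^2 + |f|^2 / \<alpha>, half of the dissipation 2 \<alpha> r^2 survives and bounds the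
  integral of r^2 by that of |f|^2 / \<alpha>^2.\<close>

lemma state_square_integral_le:
  assumes decay: "\<And>t x. t \<ge> 0 \<Longrightarrow> norm (S t x) \<le> M * exp (- \<alpha> * t) * norm x" and \<alpha>: "\<alpha> > 0"
    and f: "f \<in> borel_measurable lebesgue"
    and f_sq: "\<And>t. set_integrable lebesgue {0..t} (\<lambda>s. (norm (f s))\<^sup>2)" and T: "T \<ge> 0"
  shows "(LINT t:{0..T}|lebesgue. (norm (state f t))\<^sup>2)
    \<le> (M / \<alpha>)\<^sup>2 * (LINT t:{0..T}|lebesgue. (norm (f t))\<^sup>2)"
proof -
  interpret R: dissipative_semigroup "decay \<alpha>" 1 id_blinfun "\<lambda>x. 2 * \<alpha> * x\<^sup>2" "2 * \<alpha>"
    by (rule dissipative_decay[OF \<alpha>])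
  let ?\<phi> = "\<lambda>s. norm (f s)"
  define r where "r = R.state ?\<phi>"
  have [measurable]: "f \<in> borel_measurable lebesgue" by (rule f)
  have f_int: "set_integrable lebesgue {0..t} f" for t
    by (rule set_integrable_of_square[OF f f_sq])
  have \<phi>: "?\<phi> \<in> borel_measurable lebesgue" "set_integrable lebesgue {0..t} ?\<phi>" for t
    using f_int by (auto intro: set_integrable_norm)
  have r_cont: "continuous_on {0..} r"
    unfolding r_def by (rule R.continuous_on_state[OF \<phi>])
  have y_cont: "continuous_on {0..} (state f)"
    by (rule continuous_on_state[OF f f_int])
  have sq_int: "set_integrable lebesgue {0..T} (\<lambda>s. (r s)\<^sup>2)"
    "set_integrable lebesgue {0..T} (\<lambda>s. (norm (state f s))\<^sup>2)"
    by (intro set_integrable_continuous_lebesgue continuous_intros continuous_on_subset[OF r_cont]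
        continuous_on_subset[OF y_cont]; auto)+
  have le: "norm (state f t) \<le> M * r t" if "0 \<le> t" for t
  proof -
    have int: "set_integrable lebesgue {0..t} (\<lambda>s. flow (t - s) (f s))"
      by (intro set_integrable_flow f f_int) auto
    have intR: "set_integrable lebesgue {0..t} (\<lambda>s. M * R.flow (t - s) (?\<phi> s))"
      by (intro set_integrable_mult_right R.set_integrable_flow \<phi>) auto
    have "norm (state f t) \<le> (LINT s:{0..t}|lebesgue. norm (flow (t - s) (f s)))"
      unfolding state_def by (rule set_integral_norm_bound[OF int])
    also have "\<dots> \<le> (LINT s:{0..t}|lebesgue. M * R.flow (t - s) (?\<phi> s))"
    proof (rule set_integral_mono[OF set_integrable_norm[OF int] intR])
      fix s assume "s \<in> {0..t}"
      then show "norm (flow (t - s) (f s)) \<le> M * R.flow (t - s) (?\<phi> s)"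
        using decay[of "t - s" "f s"] by (simp add: flow_def R.flow_def mult.assoc)
    qed
    also have "\<dots> = M * r t"
      by (simp add: r_def R.state_def)
    finally show ?thesis .
  qed
  note energy = R.energy_state[OF \<phi> T, folded r_def]
  have "0 \<le> (r T)\<^sup>2" by simp
  also have "\<dots> = (LINT s:{0..T}|lebesgue. 2 * (r s * ?\<phi> s) - 2 * \<alpha> * (r s)\<^sup>2)"
    using energy(1) by (simp add: power2_eq_square)
  also have "\<dots> \<le> (LINT s:{0..T}|lebesgue. (1 / \<alpha>) * (?\<phi> s)\<^sup>2 - \<alpha> * (r s)\<^sup>2)"
  proof (rule set_integral_mono)
    show "set_integrable lebesgue {0..T} (\<lambda>s. 2 * (r s * ?\<phi> s) - 2 * \<alpha> * (r s)\<^sup>2)"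
      using energy(2) by simp
    show "set_integrable lebesgue {0..T} (\<lambda>s. (1 / \<alpha>) * (?\<phi> s)\<^sup>2 - \<alpha> * (r s)\<^sup>2)"
      by (intro set_integral_diff set_integrable_mult_right f_sq sq_int)
    fix s
    have "0 \<le> (\<alpha> * r s - ?\<phi> s)\<^sup>2 / \<alpha>" using \<alpha> by simp
    also have "(\<alpha> * r s - ?\<phi> s)\<^sup>2 / \<alpha> = \<alpha> * (r s)\<^sup>2 - 2 * (r s * ?\<phi> s) + (1 / \<alpha>) * (?\<phi> s)\<^sup>2"
      using \<alpha> by (simp add: power2_eq_square field_simps)
    finally show "2 * (r s * ?\<phi> s) - 2 * \<alpha> * (r s)\<^sup>2 \<le> (1 / \<alpha>) * (?\<phi> s)\<^sup>2 - \<alpha> * (r s)\<^sup>2"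
      by linarith
  qed
  also have "\<dots> = (1 / \<alpha>) * (LINT s:{0..T}|lebesgue. (?\<phi> s)\<^sup>2) - \<alpha> * (LINT s:{0..T}|lebesgue. (r s)\<^sup>2)"
    by (subst set_integral_diff(2)) (auto intro!: set_integrable_mult_right f_sq sq_int)
  finally have r_le: "(LINT s:{0..T}|lebesgue. (r s)\<^sup>2) \<le> (1 / \<alpha>)\<^sup>2 * (LINT s:{0..T}|lebesgue. (?\<phi> s)\<^sup>2)"
    using \<alpha> by (simp add: field_simps power2_eq_square)
  have "(LINT t:{0..T}|lebesgue. (norm (state f t))\<^sup>2) \<le> (LINT t:{0..T}|lebesgue. M\<^sup>2 * (r t)\<^sup>2)"
  proof (rule set_integral_mono)
    fix t assume "t \<in> {0..T}"
    then show "(norm (state f t))\<^sup>2 \<le> M\<^sup>2 * (r t)\<^sup>2"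
      using power_mono[OF le norm_ge_zero, of t 2] by (simp add: power_mult_distrib)
  qed (intro set_integrable_mult_right sq_int)+
  also have "\<dots> = M\<^sup>2 * (LINT t:{0..T}|lebesgue. (r t)\<^sup>2)" by simp
  also have "\<dots> \<le> M\<^sup>2 * ((1 / \<alpha>)\<^sup>2 * (LINT s:{0..T}|lebesgue. (?\<phi> s)\<^sup>2))"
    by (intro mult_left_mono r_le) simp
  finally show ?thesis by (simp add: power_divide)
qed

end

section \<open>An isometric copy of the state space\<close>

text \<open>
  The sort {real_inner, polish_space} is not a subsort of banach, which most lemmas on the Bochner
  integral require.  An isometric copy of the type can be declared an instance of banach.
\<close>

typedef (overloaded) 'a hilbert_copy = "UNIV :: 'a::real_inner set"
  morphisms of_copy to_copy ..

lemmas copy_simps [simp] = of_copy_inverse to_copy_inverse[OF UNIV_I]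

lemma of_copy_eq_iff: "x = y \<longleftrightarrow> of_copy x = of_copy y"
  by (simp add: of_copy_inject)

instantiation hilbert_copy :: (real_inner) real_inner
begin

definition "0 = to_copy 0"
definition "x + y = to_copy (of_copy x + of_copy y)"
definition "x - y = to_copy (of_copy x - of_copy y)"
definition "- x = to_copy (- of_copy x)"
definition "c *\<^sub>R x = to_copy (c *\<^sub>R of_copy x)"
definition "norm x = norm (of_copy x)"
definition "sgn x = to_copy (sgn (of_copy x))"
definition "dist x y = dist (of_copy x) (of_copy y)"
definition "x \<bullet> y = of_copy x \<bullet> of_copy y"
definition "(uniformity :: ('a hilbert_copy \<times> 'a hilbert_copy) filter) =
  (INF e\<in>{0<..}. principal {(x, y). dist x y < e})"
definition "open (U :: 'a hilbert_copy set) \<longleftrightarrow>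
  (\<forall>x\<in>U. \<forall>\<^sub>F (x', y) in uniformity. x' = x \<longrightarrow> y \<in> U)"

instance
  by standard
    (simp_all add: of_copy_eq_iff zero_hilbert_copy_def plus_hilbert_copy_def minus_hilbert_copy_def
      uminus_hilbert_copy_def scaleR_hilbert_copy_def norm_hilbert_copy_def sgn_hilbert_copy_def
      dist_hilbert_copy_def inner_hilbert_copy_def uniformity_hilbert_copy_def open_hilbert_copy_def
      dist_norm sgn_div_norm inner_simps scaleR_add_right scaleR_add_left inner_commute norm_eq_sqrt_inner)

end

lemma bounded_linear_of_copy: "bounded_linear of_copy"
  by (rule bounded_linear_intro[of _ 1])
    (simp_all add: plus_hilbert_copy_def scaleR_hilbert_copy_def norm_hilbert_copy_def)

lemma bounded_linear_to_copy: "bounded_linear to_copy"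
  by (rule bounded_linear_intro[of _ 1])
    (simp_all add: plus_hilbert_copy_def scaleR_hilbert_copy_def norm_hilbert_copy_def)

lemma norm_copy [simp]: "norm (of_copy x) = norm x" "norm (to_copy y) = norm y"
  by (simp_all add: norm_hilbert_copy_def)

instance hilbert_copy :: ("{real_inner,complete_space}") banach
proof
  fix X :: "nat \<Rightarrow> 'a hilbert_copy"
  assume "Cauchy X"
  then have "Cauchy (\<lambda>n. of_copy (X n))"
    by (rule bounded_linear.Cauchy[OF bounded_linear_of_copy])
  then obtain x where "(\<lambda>n. of_copy (X n)) \<longlonglongrightarrow> x"
    using Cauchy_convergent convergent_def by blast
  from bounded_linear.tendsto[OF bounded_linear_to_copy this] show "convergent X"
    by (auto simp: convergent_def)
qed

instance hilbert_copy :: ("{real_inner,second_countable_topology}") second_countable_topology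
proof
  obtain B :: "'a set set" where B: "countable B" "topological_basis B"
    using ex_countable_basis by blast
  have "topological_basis ((-`) of_copy ` B)"
  proof (rule topological_basisI)
    fix U assume "U \<in> (-`) of_copy ` B"
    then show "open U"
      using topological_basis_open[OF B(2)] linear_continuous_on[OF bounded_linear_of_copy, of UNIV]
      by (auto intro!: open_vimage)
  next
    fix U and x :: "'a hilbert_copy"
    assume "open U" "x \<in> U"
    then have "open (to_copy -` U)" "of_copy x \<in> to_copy -` U"
      using linear_continuous_on[OF bounded_linear_to_copy, of UNIV] by (auto intro!: open_vimage)
    then obtain V where V: "V \<in> B" "of_copy x \<in> V" "V \<subseteq> to_copy -` U"
      using B(2) topological_basisE by blast
    then have "of_copy -` V \<subseteq> U"
      by (metis copy_simps(1) subset_iff vimage_eq)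
    with V show "\<exists>W\<in>(-`) of_copy ` B. x \<in> W \<and> W \<subseteq> U" by auto
  qed
  then show "\<exists>B::'a hilbert_copy set set. countable B \<and> open = generate_topology B"
    using B(1) topological_basis_imp_subbasis by blast
qed

section \<open>Measurability and integration on the half-line\<close>

lemma borel_measurable_lebesgue_AE:
  assumes f: "f \<in> borel_measurable lebesgue" and eq: "AE x in lebesgue. f x = g x"
  shows "g \<in> borel_measurable lebesgue"
proof (rule measurableI)
  fix A :: "'b set" assume A: "A \<in> sets borel"
  show "g -` A \<inter> space lebesgue \<in> sets lebesgue"
  proof (rule complete_measure.in_sets_AE[OF completion.complete_measure_axioms])
    show "AE x in lebesgue. (x \<in> f -` A \<inter> space lebesgue) = (x \<in> g -` A \<inter> space lebesgue)"
      using eq by eventually_elim simp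
  qed (use measurable_sets[OF f A] in auto)
qed simp

lemma strongly_measurable_compose:
  assumes "strongly_measurable N f" "continuous_on UNIV h"
  shows "strongly_measurable N (\<lambda>t. h (f t))"
proof -
  obtain s where s: "\<And>i::nat. simple_function N (s i)" "AE t in N. (\<lambda>i. s i t) \<longlonglongrightarrow> f t"
    using assms(1) by (auto simp: strongly_measurable_def)
  have "AE t in N. (\<lambda>i. h (s i t)) \<longlonglongrightarrow> h (f t)"
    using s(2) by eventually_elim (simp add: continuous_on_tendsto_compose[OF assms(2)])
  then show ?thesis
    unfolding strongly_measurable_def using s(1)
    by (intro exI[of _ "\<lambda>i t. h (s i t)"]) (simp add: simple_function_compose1)
qed

lemma strongly_measurable_borel:
  fixes f :: "'t \<Rightarrow> 'a::{metric_space,second_countable_topology}"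
  assumes "f \<in> borel_measurable N"
  shows "strongly_measurable N f"
proof -
  obtain s where "\<forall>i. simple_function N (s i)" "\<forall>x\<in>space N. (\<lambda>i. s i x) \<longlonglongrightarrow> f x"
    using borel_measurable_implies_sequence_metric[OF assms] by blast
  then show ?thesis
    unfolding strongly_measurable_def by (intro exI[of _ s]) simp
qed

text \<open>The simple functions converge only almost everywhere. The \<open>lim\<close> of their
  truncations is measurable whatever value it takes where they diverge, and completeness of Lebesgue
  measure transfers this to f; admitting the endpoint 0 changes a null set.\<close>

lemma strongly_measurable_imp_borel_measurable:
  fixes f :: "real \<Rightarrow> 'a::{banach,second_countable_topology}"
  assumes "strongly_measurable half_line f"
  shows "(\<lambda>t. indicator {0..} t *\<^sub>R f t) \<in> borel_measurable lebesgue"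
proof -
  obtain s where s: "\<And>i::nat. simple_function half_line (s i)" "AE t in half_line. (\<lambda>i. s i t) \<longlonglongrightarrow> f t"
    using assms by (auto simp: strongly_measurable_def)
  define g where "g t = lim (\<lambda>i. indicator {0<..} t *\<^sub>R s i t)" for t
  have "(\<lambda>t. indicator {0<..} t *\<^sub>R s i t) \<in> borel_measurable lebesgue" for i
    using borel_measurable_simple_function[OF s(1)[of i]] by (simp add: borel_measurable_restrict_space_iff)
  then have g: "g \<in> borel_measurable lebesgue"
    unfolding g_def by (intro borel_measurable_lim_metric)
  have "AE t in lebesgue. t \<in> {0<..} \<longrightarrow> (\<lambda>i. s i t) \<longlonglongrightarrow> f t"
    using s(2) by (simp add: AE_restrict_space_iff)
  then have "AE t in lebesgue. g t = indicator {0..} t *\<^sub>R f t"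
    using AE_lebesgue_neq[of 0]
    by eventually_elim (auto simp: g_def limI split: split_indicator)
  with g show ?thesis by (rule borel_measurable_lebesgue_AE)
qed

lemma integrable_half_line_iff:
  fixes g :: "real \<Rightarrow> real"
  shows "integrable half_line g \<longleftrightarrow> set_integrable lebesgue {0<..} g"
    and "(LINT t|half_line. g t) = (LINT t:{0<..}|lebesgue. g t)"
  by (simp_all add: integrable_restrict_space integral_restrict_space set_integrable_def set_lebesgue_integral_def)

lemma half_line_integral_Icc:
  fixes g :: "real \<Rightarrow> real"
  assumes "integrable half_line g"
  shows "set_integrable lebesgue {0..T} g"
    and "(\<And>t. 0 \<le> g t) \<Longrightarrow> (LINT t:{0..T}|lebesgue. g t) \<le> (LINT t|half_line. g t)"
proof -
  have int: "set_integrable lebesgue {0<..} g" using assms by (simp add: integrable_half_line_iff)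
  then have int': "set_integrable lebesgue {0<..T} g" by (rule set_integrable_subset) auto
  have ae: "AE t in lebesgue. indicator {0<..T} t *\<^sub>R g t = indicator {0..T} t *\<^sub>R g t"
    using AE_lebesgue_neq[of 0] by eventually_elim (auto split: split_indicator)
  have m: "(\<lambda>t. indicator {0<..T} t *\<^sub>R g t) \<in> borel_measurable lebesgue"
    using int' unfolding set_integrable_def by (rule borel_measurable_integrable)
  have m': "(\<lambda>t. indicator {0..T} t *\<^sub>R g t) \<in> borel_measurable lebesgue"
    by (rule borel_measurable_lebesgue_AE[OF m ae])
  show "set_integrable lebesgue {0..T} g"
    using integrable_cong_AE[OF m m' ae] int' by (simp add: set_integrable_def)
  assume pos: "\<And>t. 0 \<le> g t"
  have "(LINT t:{0..T}|lebesgue. g t) = (LINT t:{0<..T}|lebesgue. g t)"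
    using integral_cong_AE[OF m m' ae] by (simp add: set_lebesgue_integral_def)
  also have "\<dots> \<le> (LINT t:{0<..}|lebesgue. g t)"
    unfolding set_lebesgue_integral_def
    by (rule integral_mono) (use int int' pos in \<open>auto simp: set_integrable_def split: split_indicator\<close>)
  finally show "(LINT t:{0..T}|lebesgue. g t) \<le> (LINT t|half_line. g t)"
    by (simp add: integrable_half_line_iff)
qed

text \<open>Monotone convergence along the intervals (0, n]: their integrals increase and stay below
  B, hence converge. This turns estimates on every finite horizon into one for all time.\<close>

lemma half_line_integral_le:
  fixes g :: "real \<Rightarrow> real"
  assumes pos: "\<And>t. 0 \<le> g t"
    and int: "\<And>T. T \<ge> 0 \<Longrightarrow> set_integrable lebesgue {0..T} g"
    and le: "\<And>T. T \<ge> 0 \<Longrightarrow> (LINT t:{0..T}|lebesgue. g t) \<le> B"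
  shows "integrable half_line g" and "(LINT t|half_line. g t) \<le> B"
proof -
  let ?A = "\<lambda>n::nat. {0<..real n}"
  let ?a = "\<lambda>n. LINT t:?A n|lebesgue. g t"
  have int': "set_integrable lebesgue (?A n) g" for n
    by (rule set_integrable_subset[OF int[of "real n"]]) auto
  have a_le: "?a n \<le> B" for n
  proof -
    have "?a n \<le> (LINT t:{0..real n}|lebesgue. g t)"
      unfolding set_lebesgue_integral_def
      by (rule integral_mono) (use int'[of n] int[of "real n"] pos in \<open>auto simp: set_integrable_def split: split_indicator\<close>)
    then show ?thesis using le[of "real n"] by simp
  qed
  have "incseq ?a"
  proof (rule incseq_SucI)
    fix n show "?a n \<le> ?a (Suc n)"
      unfolding set_lebesgue_integral_def
      by (rule integral_mono) (use int'[of n] int'[of "Suc n"] pos in \<open>auto simp: set_integrable_def split: split_indicator\<close>)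
  qed
  then obtain l where l: "?a \<longlonglongrightarrow> l"
    using incseq_convergent[of ?a B] a_le by blast
  have mono: "mono ?A" by (auto simp: mono_def)
  have "(\<Union>n. ?A n) = {0<..}"
    using real_arch_simple by (auto intro: less_imp_le)
  moreover have top: "set_integrable lebesgue (\<Union>n. ?A n) g"
    by (rule pos_integrable_to_top[OF _ mono _ int' l]) (auto simp: pos)
  moreover have "?a \<longlonglongrightarrow> (LINT t:(\<Union>n. ?A n)|lebesgue. g t)"
    by (rule set_integral_cont_up[OF _ mono top]) simp
  then have "(LINT t:(\<Union>n. ?A n)|lebesgue. g t) \<le> B"
    by (rule LIMSEQ_le_const2) (use a_le in auto)
  ultimately show "integrable half_line g" "(LINT t|half_line. g t) \<le> B"
    by (simp_all add: integrable_half_line_iff)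
qed

section \<open>Transfer of the mild solution to the original space\<close>

lemma blinfun_copy [simp]:
  "blinfun_apply (Blinfun to_copy) = to_copy" "blinfun_apply (Blinfun of_copy) = of_copy"
  by (simp_all add: bounded_linear_Blinfun_apply bounded_linear_to_copy bounded_linear_of_copy)

text \<open>Conjugation with the isometry turns S, P and q into data of the same kind on the copy,
  where the locale applies. Bounded linear maps commute with the Bochner integral, so y, an integral
  in the original type, is the image of the abstract state.\<close>

lemma mild_solution:
  fixes S :: "real \<Rightarrow> 'h::{real_inner,polish_space} \<Rightarrow>\<^sub>L 'h" and P :: "'h \<Rightarrow>\<^sub>L 'h" and q :: "'h \<Rightarrow> real"
  assumes C0: "C0_semigroup S"
    and decay: "\<forall>x. \<forall>t\<ge>0. norm (S t x) \<le> M * exp (- \<alpha> * t) * norm x" and M: "M > 0" and \<alpha>: "\<alpha> > 0"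
    and sym: "\<And>x y. P x \<bullet> y = x \<bullet> P y"
    and q_cont: "continuous_on UNIV q"
    and q_bound: "\<And>x. \<bar>q x\<bar> \<le> K * (norm x)\<^sup>2"
    and dissipation: "\<forall>(x, z)\<in>generator S. 2 * (P x \<bullet> z) = - q x"
    and f: "f \<in> L2"
  defines "y \<equiv> \<lambda>t. LINT s|lebesgue_on {0..t}. S (t - s) (f s)"
  shows "continuous_on {0..} y"
    and "\<And>T. T \<ge> 0 \<Longrightarrow> (LINT t:{0..T}|lebesgue. (norm (y t))\<^sup>2)
      \<le> (M / \<alpha>)\<^sup>2 * (LINT t:{0..T}|lebesgue. (norm (f t))\<^sup>2)"
    and "\<And>T. T \<ge> 0 \<Longrightarrow> P (y T) \<bullet> y T = (LINT s:{0..T}|lebesgue. 2 * (P (y s) \<bullet> f s) - q (y s))"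
    and "\<And>T. T \<ge> 0 \<Longrightarrow> set_integrable lebesgue {0..T} (\<lambda>s. 2 * (P (y s) \<bullet> f s) - q (y s))"
proof -
  define S' where "S' t = Blinfun to_copy o\<^sub>L S t o\<^sub>L Blinfun of_copy" for t
  define P' where "P' = Blinfun to_copy o\<^sub>L P o\<^sub>L Blinfun of_copy"
  have S'[simp]: "S' t x = to_copy (S t (of_copy x))" for t x by (simp add: S'_def)
  have P'[simp]: "P' x = to_copy (P (of_copy x))" for x by (simp add: P'_def)
  have decay': "norm (S' t x) \<le> M * exp (- \<alpha> * t) * norm x" if "t \<ge> 0" for t x
    using decay that by (simp flip: norm_copy(1))
  interpret D: dissipative_semigroup S' M P' "\<lambda>x. q (of_copy x)" K
  proof
    have "((\<lambda>t. to_copy (S t (of_copy x))) \<longlongrightarrow> to_copy (of_copy x)) (at_right 0)" for x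
      using C0 by (intro bounded_linear.tendsto[OF bounded_linear_to_copy]) (simp add: C0_semigroup_def)
    then show "C0_semigroup S'"
      using C0 by (auto simp: C0_semigroup_def intro!: blinfun_eqI)
    show "norm (S' t x) \<le> M * norm x" if "t \<ge> 0" for t x
    proof -
      have "M * exp (- \<alpha> * t) * norm x \<le> M * 1 * norm x"
        using M \<alpha> that by (intro mult_right_mono mult_left_mono) auto
      then show ?thesis using decay'[OF that, of x] by simp
    qed
    show "P' x \<bullet> y = x \<bullet> P' y" for x y
      by (simp add: inner_hilbert_copy_def sym)
    show "continuous_on UNIV (\<lambda>x. q (of_copy x))"
      by (intro continuous_on_compose2[OF q_cont] linear_continuous_on bounded_linear_of_copy) auto
    show "\<bar>q (of_copy x)\<bar> \<le> K * (norm x)\<^sup>2" for x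
      using q_bound[of "of_copy x"] by simp
    show "2 * (P' x \<bullet> z) = - q (of_copy x)" if "(x, z) \<in> generator S'" for x z
    proof -
      have "((\<lambda>t. (1 / t) *\<^sub>R (S' t x - x)) \<longlongrightarrow> z) (at_right 0)"
        using that by (simp add: generator_def)
      from bounded_linear.tendsto[OF bounded_linear_of_copy this]
      have "(of_copy x, of_copy z) \<in> generator S"
        by (simp add: generator_def scaleR_hilbert_copy_def minus_hilbert_copy_def)
      with dissipation show ?thesis by (auto simp: inner_hilbert_copy_def)
    qed
  qed (use M in auto)
  \<comment> \<open>An element of \<open>L2\<close> is constrained only at positive times; extension
    by zero makes it measurable on the whole line and leaves it unchanged for t >= 0.\<close>
  define f' where "f' t = indicator {0..} t *\<^sub>R to_copy (f t)" for t
  have f'_eq: "f' t = to_copy (f t)" if "t \<ge> 0" for t using that by (simp add: f'_def)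
  have f'_meas: "f' \<in> borel_measurable lebesgue"
  proof -
    have "strongly_measurable half_line f" using f by (simp add: L2_def)
    from strongly_measurable_compose[OF this linear_continuous_on[OF bounded_linear_to_copy]]
    show ?thesis
      unfolding f'_def[abs_def] by (rule strongly_measurable_imp_borel_measurable)
  qed
  have f_sq: "set_integrable lebesgue {0..t} (\<lambda>s. (norm (f s))\<^sup>2)" for t
    using f by (intro half_line_integral_Icc) (simp add: L2_def)
  have f'_sq: "set_integrable lebesgue {0..t} (\<lambda>s. (norm (f' s))\<^sup>2)" for t
    by (rule set_integrable_cong[THEN iffD1, OF refl refl _ f_sq[of t]]) (simp add: f'_eq)
  have f'_int: "set_integrable lebesgue {0..t} f'" for t
    by (rule set_integrable_of_square[OF f'_meas f'_sq])
  have y: "y t = of_copy (D.state f' t)" if "t \<ge> 0" for t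
  proof -
    have int: "integrable (lebesgue_on {0..t}) (\<lambda>s. D.flow (t - s) (f' s))"
      using D.set_integrable_flow[OF f'_meas f'_int[of t], of t]
      by (simp add: integrable_restrict_space set_integrable_def)
    have "(LINT s|lebesgue_on {0..t}. D.flow (t - s) (f' s)) = D.state f' t"
      by (simp add: integral_restrict_space D.state_def set_lebesgue_integral_def)
    with has_bochner_integral_bounded_linear[OF bounded_linear_of_copy has_bochner_integral_integrable[OF int]]
    have "has_bochner_integral (lebesgue_on {0..t}) (\<lambda>s. of_copy (D.flow (t - s) (f' s))) (of_copy (D.state f' t))"
      by simp
    \<comment> \<open>For s in [0, t] the elapsed time t - s is nonnegative, so the clamping inside
      \<open>D.flow\<close> has no effect.\<close>
    also have "?this \<longleftrightarrow> has_bochner_integral (lebesgue_on {0..t}) (\<lambda>s. S (t - s) (f s)) (of_copy (D.state f' t))"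
      by (intro has_bochner_integral_cong) (auto simp: D.flow_def f'_eq)
    finally show ?thesis unfolding y_def by (rule has_bochner_integral_integral_eq)
  qed
  have "continuous_on {0..} (\<lambda>t. of_copy (D.state f' t))"
    by (rule continuous_on_compose2[OF linear_continuous_on[OF bounded_linear_of_copy, of UNIV]
          D.continuous_on_state[OF f'_meas f'_int]]) simp
  then show "continuous_on {0..} y"
    by (rule continuous_on_eq) (simp add: y)
  fix T :: real assume T: "T \<ge> 0"
  have "(LINT t:{0..T}|lebesgue. (norm (y t))\<^sup>2) = (LINT t:{0..T}|lebesgue. (norm (D.state f' t))\<^sup>2)"
    by (intro set_lebesgue_integral_cong) (auto simp: y)
  also have "\<dots> \<le> (M / \<alpha>)\<^sup>2 * (LINT t:{0..T}|lebesgue. (norm (f' t))\<^sup>2)"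
    by (rule D.state_square_integral_le[OF decay' \<alpha> f'_meas f'_sq T])
  also have "(LINT t:{0..T}|lebesgue. (norm (f' t))\<^sup>2) = (LINT t:{0..T}|lebesgue. (norm (f t))\<^sup>2)"
    by (intro set_lebesgue_integral_cong) (auto simp: f'_eq)
  finally show "(LINT t:{0..T}|lebesgue. (norm (y t))\<^sup>2)
      \<le> (M / \<alpha>)\<^sup>2 * (LINT t:{0..T}|lebesgue. (norm (f t))\<^sup>2)" .
  have pt: "2 * (P' (D.state f' s) \<bullet> f' s) - q (of_copy (D.state f' s)) = 2 * (P (y s) \<bullet> f s) - q (y s)"
    if "s \<in> {0..T}" for s
    using that by (simp add: y f'_eq inner_hilbert_copy_def)
  show "P (y T) \<bullet> y T = (LINT s:{0..T}|lebesgue. 2 * (P (y s) \<bullet> f s) - q (y s))"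
  proof -
    have "P (y T) \<bullet> y T = P' (D.state f' T) \<bullet> D.state f' T"
      using T by (simp add: y inner_hilbert_copy_def)
    also have "\<dots> = (LINT s:{0..T}|lebesgue. 2 * (P (y s) \<bullet> f s) - q (y s))"
      unfolding D.energy_state(1)[OF f'_meas f'_int T]
      by (intro set_lebesgue_integral_cong) (simp_all add: pt del: P')
    finally show ?thesis .
  qed
  show "set_integrable lebesgue {0..T} (\<lambda>s. 2 * (P (y s) \<bullet> f s) - q (y s))"
    by (rule set_integrable_cong[THEN iffD1, OF refl refl _ D.energy_state(2)[OF f'_meas f'_int T]]) (rule pt)
qed

section \<open>Membership in \<open>L2\<close>\<close>

lemma L2_I:
  assumes f: "strongly_measurable half_line f" and h: "integrable half_line h"
    and le: "\<And>t. (norm (f t))\<^sup>2 \<le> h t"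
  shows "f \<in> L2"
proof -
  have "strongly_measurable half_line (\<lambda>t. norm (f t))"
    by (rule strongly_measurable_compose[OF f]) (intro continuous_intros)
  from measurable_restrict_space1[OF strongly_measurable_imp_borel_measurable[OF this], of "{0<..}"]
  have "(\<lambda>t. norm (f t)) \<in> borel_measurable half_line"
    by (rule measurable_cong[THEN iffD1, rotated]) simp
  then have "(\<lambda>t. (norm (f t))\<^sup>2) \<in> borel_measurable half_line"
    by (rule borel_measurable_power)
  moreover have "AE t in half_line. norm ((norm (f t))\<^sup>2) \<le> norm (h t)"
    using le order_trans[OF zero_le_power2 le] by simp
  ultimately have "integrable half_line (\<lambda>t. (norm (f t))\<^sup>2)"
    by (rule Bochner_Integration.integrable_bound[OF h])
  with f show ?thesis by (simp add: L2_def)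
qed

lemma L2_bounded_linear:
  assumes T: "bounded_linear T" and g: "g \<in> L2"
  shows "(\<lambda>t. T (g t)) \<in> L2"
proof -
  obtain k where k: "\<And>x. norm (T x) \<le> norm x * k" using bounded_linear.bounded[OF T] by blast
  show ?thesis
  proof (rule L2_I)
    show "strongly_measurable half_line (\<lambda>t. T (g t))"
      using g by (intro strongly_measurable_compose[OF _ linear_continuous_on[OF T]]) (simp add: L2_def)
    show "integrable half_line (\<lambda>t. k\<^sup>2 * (norm (g t))\<^sup>2)"
      using g by (simp add: L2_def)
    show "(norm (T (g t)))\<^sup>2 \<le> k\<^sup>2 * (norm (g t))\<^sup>2" for t
      using power_mono[OF k norm_ge_zero, of "g t" 2] by (simp add: power_mult_distrib mult.commute)
  qed
qed

lemma strongly_measurable_continuous: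
  fixes f :: "real \<Rightarrow> 'a::{real_normed_vector,second_countable_topology}"
  assumes "continuous_on {0..} f"
  shows "strongly_measurable half_line f"
proof (rule strongly_measurable_borel)
  have "(\<lambda>t. indicator {0..} t *\<^sub>R f t) \<in> borel_measurable borel"
    by (rule borel_measurable_continuous_on_indicator[OF _ assms]) simp
  then have "(\<lambda>t. indicator {0..} t *\<^sub>R f t) \<in> borel_measurable lebesgue"
    by (intro measurable_completion) simp
  from measurable_restrict_space1[OF this, of "{0<..}"] show "f \<in> borel_measurable half_line"
    by (rule measurable_cong[THEN iffD1, rotated]) simp
qed

section \<open>The dissipation law hidden in the Riccati equation\<close>

text \<open>The middle term is the squared norm of the feedback control. For \<gamma> > 0 the last
  term is the maximum of 2 (P x, B1 w) - \<gamma>^2 |w|^2 over all w, attained at w = B1* P x /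
  \<gamma>^2: a reserve that covers the worst disturbance.\<close>

definition dissipation_rate ::
  "real \<Rightarrow> ('w::real_inner \<Rightarrow>\<^sub>L 'h::real_inner) \<Rightarrow> ('u::real_inner \<Rightarrow>\<^sub>L 'h) \<Rightarrow> ('h \<Rightarrow>\<^sub>L 'h) \<Rightarrow> ('h \<Rightarrow>\<^sub>L 'h) \<Rightarrow> 'h \<Rightarrow> real"
  where
  "dissipation_rate \<gamma> B1 B2 C1 P x =
    (norm (C1 x))\<^sup>2 + (norm (adjoint B2 (P x)))\<^sup>2 + (norm (adjoint B1 (P x)))\<^sup>2 / \<gamma>\<^sup>2"

text \<open>For x in the domain, x = \<iota> v and A v is the functional of some h in H, so the
  equation in V' can be tested with v: through PV, PD and the symmetry of P both terms with A become
  (h, P x). The feedback adds -2 |B2* P x|^2 to 2 (P x, z), which turns the gain |B2* P x|^2 coming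
  from the Riccati equation into a loss of the same size.\<close>

lemma riccati_dissipation:
  fixes \<iota> :: "'v::{real_inner,complete_space} \<Rightarrow>\<^sub>L 'h::{real_inner,complete_space}"
    and B1 :: "'w::{real_inner,complete_space} \<Rightarrow>\<^sub>L 'h"
    and B2 :: "'u::{real_inner,complete_space} \<Rightarrow>\<^sub>L 'h"
  assumes calV: "in_calV \<iota> P PV PD" and sym: "\<And>x y. P x \<bullet> y = x \<bullet> P y"
    and ric: "riccati \<iota> A (Gam \<gamma> B1 B2) C1 P PV PD"
    and xz: "(x, z) \<in> minus_plus \<iota> A (\<lambda>x. - B2 (adjoint B2 (P x)))"
  shows "2 * (P x \<bullet> z) = - dissipation_rate \<gamma> B1 B2 C1 P x"
proof -
  obtain v h where x: "x = \<iota> v" and z: "z = - h - B2 (adjoint B2 (P x))" and Av: "A v = pivot \<iota> h"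
    using xz by (auto simp: minus_plus_def)
  have sq: "B (adjoint B y) \<bullet> y = (norm (adjoint B y))\<^sup>2"
    for B :: "'a::{real_inner,complete_space} \<Rightarrow>\<^sub>L 'h" and y
    by (simp add: inner_adjoint power2_norm_eq_inner)
  have "dual_op A (PV (\<iota> v)) v + pivot \<iota> (PD (A v)) v + pivot \<iota> (P (Gam \<gamma> B1 B2 (P (\<iota> v)))) v
      = pivot \<iota> (adjoint C1 (C1 (\<iota> v))) v"
    using ric unfolding riccati_def by (metis blinfun.add_left)
  then have "h \<bullet> P x + P h \<bullet> x + P (Gam \<gamma> B1 B2 (P x)) \<bullet> x = adjoint C1 (C1 x) \<bullet> x"
    using calV by (simp add: dual_op_apply pivot_apply Av in_calV_def flip: x)
  moreover have "adjoint C1 (C1 x) \<bullet> x = (norm (C1 x))\<^sup>2"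
    using inner_adjoint[of C1 x "C1 x"] by (simp add: power2_norm_eq_inner inner_commute)
  moreover have "P (Gam \<gamma> B1 B2 (P x)) \<bullet> x
      = (norm (adjoint B2 (P x)))\<^sup>2 - (norm (adjoint B1 (P x)))\<^sup>2 / \<gamma>\<^sup>2"
    unfolding sym[of _ x] by (simp add: Gam_def inner_simps sq)
  moreover have "P x \<bullet> z = - (h \<bullet> P x) - (norm (adjoint B2 (P x)))\<^sup>2"
    using sq[of B2 "P x"] by (simp add: z inner_simps inner_commute)
  moreover have "P h \<bullet> x = h \<bullet> P x" by (rule sym)
  ultimately show ?thesis by (simp add: dissipation_rate_def)
qed

lemma dissipation_rate_continuous:
  fixes B1 :: "'w::{real_inner,complete_space} \<Rightarrow>\<^sub>L 'h::real_inner"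
    and B2 :: "'u::{real_inner,complete_space} \<Rightarrow>\<^sub>L 'h"
  shows "continuous_on UNIV (dissipation_rate \<gamma> B1 B2 C1 P)"
    and "\<exists>K. \<forall>x. \<bar>dissipation_rate \<gamma> B1 B2 C1 P x\<bar> \<le> K * (norm x)\<^sup>2"
proof -
  have adj: "bounded_linear (\<lambda>x. adjoint B (P x))" for B :: "'a::{real_inner,complete_space} \<Rightarrow>\<^sub>L 'h"
    by (rule bounded_linear_compose[OF bounded_linear_adjoint[of B] blinfun.bounded_linear_right[of P]])
  show "continuous_on UNIV (dissipation_rate \<gamma> B1 B2 C1 P)"
    unfolding dissipation_rate_def divide_inverse
    by (intro continuous_intros linear_continuous_on adj)
  have sq: "\<exists>k. \<forall>x. (norm (f x))\<^sup>2 \<le> k * (norm x)\<^sup>2" if f: "bounded_linear f" for f :: "'h \<Rightarrow> 'a::real_inner"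
  proof -
    obtain k where "\<And>x. norm (f x) \<le> norm x * k" using bounded_linear.bounded[OF f] by blast
    then have "(norm (f x))\<^sup>2 \<le> k\<^sup>2 * (norm x)\<^sup>2" for x
      using power_mono[of "norm (f x)" "norm x * k" 2] by (simp add: power_mult_distrib mult.commute)
    then show ?thesis by blast
  qed
  obtain k0 k1 k2 where k: "\<And>x. (norm (C1 x))\<^sup>2 \<le> k0 * (norm x)\<^sup>2"
    "\<And>x. (norm (adjoint B1 (P x)))\<^sup>2 \<le> k1 * (norm x)\<^sup>2" "\<And>x. (norm (adjoint B2 (P x)))\<^sup>2 \<le> k2 * (norm x)\<^sup>2"
    using sq[OF blinfun.bounded_linear_right[of C1]] sq[OF adj[of B1]] sq[OF adj[of B2]] by blast
  have "\<bar>dissipation_rate \<gamma> B1 B2 C1 P x\<bar> \<le> (k0 + k2 + k1 / \<gamma>\<^sup>2) * (norm x)\<^sup>2" for x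
    using k(1)[of x] k(3)[of x] divide_right_mono[OF k(2)[of x] zero_le_power2[of \<gamma>]]
    by (simp add: dissipation_rate_def algebra_simps)
  then show "\<exists>K. \<forall>x. \<bar>dissipation_rate \<gamma> B1 B2 C1 P x\<bar> \<le> K * (norm x)\<^sup>2" by blast
qed

section \<open>The gain estimate for the closed loop\<close>

theorem theorem4p1:
  fixes \<gamma> :: real
    and \<iota> :: "'v::{real_inner, polish_space} \<Rightarrow>\<^sub>L 'h::{real_inner, polish_space}"
    and A :: "'v \<Rightarrow>\<^sub>L ('v \<Rightarrow>\<^sub>L real)"
    and B1 :: "'w::{real_inner, complete_space} \<Rightarrow>\<^sub>L 'h"
    and B2 :: "'u::{real_inner, complete_space} \<Rightarrow>\<^sub>L 'h"
    and C1 :: "'h \<Rightarrow>\<^sub>L 'h"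
    and P :: "'h \<Rightarrow>\<^sub>L 'h"
    and PV :: "'h \<Rightarrow>\<^sub>L 'v"
    and PD :: "('v \<Rightarrow>\<^sub>L real) \<Rightarrow>\<^sub>L 'h"
    and \<Phi> :: "(real \<Rightarrow> 'h) \<Rightarrow> (real \<Rightarrow> 'u) \<Rightarrow> (real \<Rightarrow> 'h)"
  defines "\<Gamma> \<equiv> Gam \<gamma> B1 B2"
  assumes "compact_gelfand_triple \<iota>"
    and "\<gamma> > 0"
    and "\<exists>T. generates (minus_plus \<iota> A (\<lambda>x. 0)) T"
    and "((\<exists>\<omega>>0. \<forall>y. A y y \<ge> \<omega> * (norm y)\<^sup>2) \<and>
          hilbert_schmidt \<Gamma> \<and> \<Gamma> = adjoint \<Gamma> \<and> (\<forall>y. \<Gamma> y \<bullet> y \<ge> 0) \<and>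
          hilbert_schmidt C1)
       \<or> ((\<forall>y. A y y \<ge> 0) \<and>
          (\<exists>CD :: ('v \<Rightarrow>\<^sub>L real) \<Rightarrow>\<^sub>L 'h.
             hilbert_schmidt_dual CD \<and> (\<forall>x. CD (pivot \<iota> x) = C1 x) \<and> {\<xi>. CD \<xi> = 0} = {0}) \<and>
          hilbert_schmidt \<Gamma> \<and> \<Gamma> = adjoint \<Gamma> \<and>
          (\<exists>g0>0. \<forall>y. \<Gamma> y \<bullet> y \<ge> g0 * (norm y)\<^sup>2))"
    and "in_calV \<iota> P PV PD"
    and "blinfun_apply P = adjoint P"
    and "\<forall>y. P y \<bullet> y \<ge> 0"
    and "riccati \<iota> A \<Gamma> C1 P PV PD"
    and "\<exists>S. generates (minus_plus \<iota> A (\<lambda>x. - B2 (adjoint B2 (P x)))) S \<and> exponentially_stable S"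
    and "L2_map \<Phi>"
    and "\<forall>y\<in>L2. \<forall>u\<in>L2. AE t in half_line.
           (norm (\<Phi> y u t))\<^sup>2 \<le> (norm (C1 (y t)))\<^sup>2 + (norm (u t))\<^sup>2"
  shows "solves_Hinf_problem \<gamma> \<iota> A B1 B2 \<Phi> (\<lambda>x. - adjoint B2 (P x))"
proof -
  obtain S where gen: "generates (minus_plus \<iota> A (\<lambda>x. - B2 (adjoint B2 (P x)))) S"
    and stable: "exponentially_stable S"
    using \<open>\<exists>S. generates (minus_plus \<iota> A (\<lambda>x. - B2 (adjoint B2 (P x)))) S \<and> exponentially_stable S\<close>
    by blast
  then obtain M \<alpha> where M: "M > 0" and \<alpha>: "\<alpha> > 0"
    and decay: "\<forall>x. \<forall>t\<ge>0. norm (S t x) \<le> M * exp (- \<alpha> * t) * norm x"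
    unfolding exponentially_stable_def by blast
  have \<gamma>: "\<gamma> > 0" by fact
  have sym: "P x \<bullet> y = x \<bullet> P y" for x y
    using inner_adjoint[of P x y] \<open>blinfun_apply P = adjoint P\<close> by simp
  let ?q = "dissipation_rate \<gamma> B1 B2 C1 P"
  have dissipation: "\<forall>(x, z)\<in>generator S. 2 * (P x \<bullet> z) = - ?q x"
    using gen riccati_dissipation[OF \<open>in_calV \<iota> P PV PD\<close> sym] \<open>riccati \<iota> A \<Gamma> C1 P PV PD\<close>
    unfolding \<Gamma>_def generates_def by blast
  obtain K where K: "\<And>x. \<bar>?q x\<bar> \<le> K * (norm x)\<^sup>2" using dissipation_rate_continuous(2) by blast
  have fb: "bounded_linear (\<lambda>x. - adjoint B2 (P x))"
    by (intro bounded_linear_minus bounded_linear_compose[OF bounded_linear_adjoint[of B2] blinfun.bounded_linear_right[of P]])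
  have Hinf: "y \<in> L2 \<and> u \<in> L2 \<and> \<Phi> y u \<in> L2 \<and> L2_norm (\<Phi> y u) \<le> \<gamma> * L2_norm w"
    if w: "w \<in> L2" and y_def: "y = mild_state S B1 w" and u_def: "u = (\<lambda>t. - adjoint B2 (P (y t)))" for w y u
  proof -
    have w_sq: "integrable half_line (\<lambda>t. (norm (w t))\<^sup>2)"
      using w by (simp add: L2_def)
    have y_eq: "(LINT s|lebesgue_on {0..t}. S (t - s) (B1 (w s))) = y t" for t
      by (simp add: y_def mild_state_def)
    have f: "(\<lambda>t. B1 (w t)) \<in> L2" by (rule L2_bounded_linear[OF blinfun.bounded_linear_right w])
    have C0: "C0_semigroup S" using gen by (simp add: generates_def)
    note mild = mild_solution[where K = K, OF C0 decay M \<alpha> sym dissipation_rate_continuous(1) K dissipation f,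
        unfolded y_eq]
    have sq_y: "set_integrable lebesgue {0..T} (\<lambda>t. (norm (R (y t)))\<^sup>2)" if "bounded_linear R"
      for R :: "'h \<Rightarrow> 'z::real_normed_vector" and T
    proof -
      have "continuous_on {0..T} (\<lambda>t. R (y t))"
        by (rule continuous_on_compose2[OF linear_continuous_on[OF that, of UNIV]
              continuous_on_subset[OF mild(1)]]) auto
      then show ?thesis by (intro set_integrable_continuous_lebesgue continuous_intros)
    qed
    have f_sq: "integrable half_line (\<lambda>t. (norm (B1 (w t)))\<^sup>2)" using f by (simp add: L2_def)
    \<comment> \<open>Exponential decay gives a bound that does not depend on T, namely a multiple
      of the energy of B1 w over the whole half-line.\<close>
    have "integrable half_line (\<lambda>t. (norm (y t))\<^sup>2)"
    proof (rule half_line_integral_le(1))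
      fix T :: real assume T: "T \<ge> 0"
      show "set_integrable lebesgue {0..T} (\<lambda>t. (norm (y t))\<^sup>2)"
        by (rule sq_y[OF bounded_linear_ident])
      have "(LINT t:{0..T}|lebesgue. (norm (y t))\<^sup>2)
          \<le> (M / \<alpha>)\<^sup>2 * (LINT t:{0..T}|lebesgue. (norm (B1 (w t)))\<^sup>2)"
        by (rule mild(2)[OF T])
      also have "\<dots> \<le> (M / \<alpha>)\<^sup>2 * (LINT t|half_line. (norm (B1 (w t)))\<^sup>2)"
        by (intro mult_left_mono half_line_integral_Icc(2) f_sq) auto
      finally show "(LINT t:{0..T}|lebesgue. (norm (y t))\<^sup>2)
          \<le> (M / \<alpha>)\<^sup>2 * (LINT t|half_line. (norm (B1 (w t)))\<^sup>2)" .
    qed simp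
    then have y: "y \<in> L2"
      using strongly_measurable_continuous[OF mild(1)] by (simp add: L2_def)
    then have u: "u \<in> L2" unfolding u_def by (rule L2_bounded_linear[OF fb])
    have z: "\<Phi> y u \<in> L2" using \<open>L2_map \<Phi>\<close> y u by (simp add: L2_map_def)
    \<comment> \<open>The pointwise bound for |\<Phi> y u|^2. It is integrated over [0, T] first,
      where the energy identity is available, and T is sent to infinity afterwards.\<close>
    define e where "e t = (norm (C1 (y t)))\<^sup>2 + (norm (u t))\<^sup>2" for t
    have e_int: "set_integrable lebesgue {0..T} e" for T
      unfolding e_def[abs_def] u_def by (intro set_integral_add sq_y blinfun.bounded_linear_right fb)
    have e_le: "(LINT t:{0..T}|lebesgue. e t) \<le> \<gamma>\<^sup>2 * (LINT t|half_line. (norm (w t))\<^sup>2)" if T: "T \<ge> 0" for T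
    proof -
      have w_int: "set_integrable lebesgue {0..T} (\<lambda>t. \<gamma>\<^sup>2 * (norm (w t))\<^sup>2)"
        by (intro set_integrable_mult_right half_line_integral_Icc w_sq)
      \<comment> \<open>The energy still stored at time T is nonnegative and is dropped; the system
        starts at rest, so there is no initial term.\<close>
      have "0 \<le> P (y T) \<bullet> y T" using \<open>\<forall>y. P y \<bullet> y \<ge> 0\<close> by blast
      also have "\<dots> = (LINT s:{0..T}|lebesgue. 2 * (P (y s) \<bullet> B1 (w s)) - ?q (y s))"
        by (rule mild(3)[OF T])
      also have "\<dots> \<le> (LINT s:{0..T}|lebesgue. \<gamma>\<^sup>2 * (norm (w s))\<^sup>2 - e s)"
      proof (rule set_integral_mono[OF mild(4)[OF T] set_integral_diff(1)[OF w_int e_int]])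
        fix s
        let ?b = "adjoint B1 (P (y s))"
        have "P (y s) \<bullet> B1 (w s) = w s \<bullet> ?b"
          by (simp add: inner_commute[of "P (y s)"] inner_adjoint[of B1])
        also have "\<dots> \<le> norm (w s) * norm ?b" by (rule norm_cauchy_schwarz)
        finally have "2 * (P (y s) \<bullet> B1 (w s)) \<le> 2 * (norm (w s) * norm ?b)" by simp
        \<comment> \<open>Completing the square, in the norms after Cauchy-Schwarz. The term |b|^2 /
          \<gamma>^2 cancels the last term of \<open>dissipation_rate\<close>, and what is left is
          \<gamma>^2 |w|^2 minus e.\<close>
        moreover have "(norm ?b / \<gamma> - \<gamma> * norm (w s))\<^sup>2
            = (norm ?b)\<^sup>2 / \<gamma>\<^sup>2 + \<gamma>\<^sup>2 * (norm (w s))\<^sup>2 - 2 * (norm (w s) * norm ?b)"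
          using \<gamma> by (simp add: power2_diff power_divide power_mult_distrib)
        moreover have "0 \<le> (norm ?b / \<gamma> - \<gamma> * norm (w s))\<^sup>2" by simp
        ultimately show "2 * (P (y s) \<bullet> B1 (w s)) - ?q (y s) \<le> \<gamma>\<^sup>2 * (norm (w s))\<^sup>2 - e s"
          by (simp add: dissipation_rate_def e_def u_def)
      qed
      also have "\<dots> = \<gamma>\<^sup>2 * (LINT s:{0..T}|lebesgue. (norm (w s))\<^sup>2) - (LINT s:{0..T}|lebesgue. e s)"
        by (subst set_integral_diff(2)[OF w_int e_int]) simp
      also have "\<dots> \<le> \<gamma>\<^sup>2 * (LINT t|half_line. (norm (w t))\<^sup>2) - (LINT s:{0..T}|lebesgue. e s)"
        by (intro diff_right_mono mult_left_mono half_line_integral_Icc(2) w_sq) auto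
      finally show ?thesis by simp
    qed
    note e = half_line_integral_le[OF _ e_int e_le]
    have e_pos: "0 \<le> e t" for t by (simp add: e_def)
    have "(LINT t|half_line. (norm (\<Phi> y u t))\<^sup>2) \<le> (LINT t|half_line. e t)"
    proof (rule integral_mono_AE)
      show "AE t in half_line. (norm (\<Phi> y u t))\<^sup>2 \<le> e t"
        unfolding e_def
        using \<open>\<forall>y\<in>L2. \<forall>u\<in>L2. AE t in half_line.
           (norm (\<Phi> y u t))\<^sup>2 \<le> (norm (C1 (y t)))\<^sup>2 + (norm (u t))\<^sup>2\<close> y u by blast
    qed (use z e(1) e_pos in \<open>auto simp: L2_def\<close>)
    also have "\<dots> \<le> \<gamma>\<^sup>2 * (LINT t|half_line. (norm (w t))\<^sup>2)"
      by (rule e(2)[OF e_pos])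
    finally have "L2_norm (\<Phi> y u) \<le> sqrt (\<gamma>\<^sup>2 * (LINT t|half_line. (norm (w t))\<^sup>2))"
      unfolding L2_norm_def by (rule real_sqrt_le_mono)
    also have "\<dots> = \<gamma> * L2_norm w"
      using \<gamma> by (simp add: real_sqrt_mult L2_norm_def)
    finally show ?thesis using y u z by blast
  qed
  \<comment> \<open>Linearity of B2 moves the sign outside, so the closed loop for this feedback has
    the generator of S and inherits its stability.\<close>
  have "generates (minus_plus \<iota> A (\<lambda>x. B2 (- adjoint B2 (P x)))) S"
    using gen by (simp add: blinfun.minus_right)
  then show ?thesis
    unfolding solves_Hinf_problem_def Let_def using stable Hinf by blast
qed

end
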